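(* For all integers $k\ge d$ and every $0<\epsilon\le1$ there is a randomized algorithm, running in time polynomial in $n,d,k$ and $1/\epsilon$, that given $v_1,\dots,v_n\in\mathbb{R}^d$ spanning $\mathbb{R}^d$ outputs $X\in\mathbb{Z}_{\ge0}^n$ with $\sum_iX_i=k$ such that $$\mathbb{E}\Big[\operatorname{tr}\Big(\big(\textstyle\sum_{i=1}^nX_iv_iv_i^\top\big)^{-1}\Big)\Big]\le\Big(\frac{k}{k-d+1}+\epsilon\Big)\mathrm{OPT}_{\mathrm{rep}}.$$ In particular, there is such a $(1+\epsilon)$-approximation algorithm when $k\ge d+\frac d\epsilon$.
   Context: The A-optimal design problem with repetitions: given $v_1,\dots,v_n\in\mathbb{R}^d$ and an integer $k\ge d$, find $X\in\mathbb{Z}_{\ge0}^n$ with $\sum_i X_i=k$ minimizing $\operatorname{tr}\big((\sum_i X_iv_iv_i^\top)^{-1}\big)$ (value $+\infty$ if singular); $\mathrm{OPT}_{\mathrm{rep}}$ denotes the minimum value. *)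

theory Defs
  imports
    "HOL-Probability.Probability_Mass_Function"
    "Jordan_Normal_Form.Gauss_Jordan_Elimination"
    "Jordan_Normal_Form.VS_Connect"
begin

section \<open>A-optimal design with repetitions\<close>

text \<open>Vectors \<open>v 0, \<dots>, v (n - 1)\<close> of dimension \<open>d\<close>; \<open>d\<close> is a number rather than a type because
  a single algorithm has to serve all dimensions.\<close>

definition info_mat :: "nat \<Rightarrow> nat \<Rightarrow> (nat \<Rightarrow> real vec) \<Rightarrow> (nat \<Rightarrow> nat) \<Rightarrow> real mat" where
  "info_mat n d v X =
     mat d d (\<lambda>(a, b). \<Sum>i<n. real (X i) * (vec_index (v i) a * vec_index (v i) b))"

definition mat_trace :: "real mat \<Rightarrow> real" where
  "mat_trace A = (\<Sum>i<dim_row A. A $$ (i, i))"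

text \<open>\<open>mat_inverse\<close> returns \<open>None\<close> exactly on singular matrices. The coercion \<open>ennreal\<close> loses nothing:
  \<open>info_mat\<close> is positive semidefinite, so its inverse, if any, has nonnegative trace.\<close>

definition a_value :: "nat \<Rightarrow> nat \<Rightarrow> (nat \<Rightarrow> real vec) \<Rightarrow> (nat \<Rightarrow> nat) \<Rightarrow> ennreal" where
  "a_value n d v X =
     (case mat_inverse (info_mat n d v X) of None \<Rightarrow> \<infinity> | Some B \<Rightarrow> ennreal (mat_trace B))"

definition designs :: "nat \<Rightarrow> nat \<Rightarrow> (nat \<Rightarrow> nat) set" where
  "designs n k = {X. (\<Sum>i<n. X i) = k}"

definition OPT_rep :: "nat \<Rightarrow> nat \<Rightarrow> nat \<Rightarrow> (nat \<Rightarrow> real vec) \<Rightarrow> ennreal" where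
  "OPT_rep n d k v = (INF X\<in>designs n k. a_value n d v X)"

definition spanning_vectors :: "nat \<Rightarrow> nat \<Rightarrow> (nat \<Rightarrow> real vec) \<Rightarrow> bool" where
  "spanning_vectors n d v \<longleftrightarrow>
     (\<forall>i<n. v i \<in> carrier_vec d) \<and>
     LinearCombinations.module.span class_ring (module_vec TYPE(real) d) (v ` {..<n}) = carrier_vec d"

section \<open>Randomized algorithms over the reals\<close>

text \<open>
  The inputs are arbitrary real vectors and the running time is measured in \<open>n\<close>, \<open>d\<close>, \<open>k\<close> and
  \<open>1/\<epsilon>\<close> only, so the model of computation is a real RAM: exact field arithmetic and comparison of
  real numbers at unit cost. There is no rounding of reals to integers, and the only constants are
  natural numbers, so that nothing noncomputable can be hidden in the text of a program.
  Natural numbers, which also serve as addresses, have only addition and truncated subtraction.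

  There is one memory for naturals and one for reals; a cell is addressed by the name of an array,
  which is fixed in the program text, and two computed indices.
\<close>

record state =
  nmem :: "nat \<times> nat \<times> nat \<Rightarrow> nat"
  rmem :: "nat \<times> nat \<times> nat \<Rightarrow> real"

datatype nexp =
    NConst nat
  | NCell nat nexp nexp
  | NAdd nexp nexp
  | NSub nexp nexp

datatype rexp =
    OfNat nexp
  | RCell nat nexp nexp
  | RAdd rexp rexp
  | RSub rexp rexp
  | RMul rexp rexp
  | RDiv rexp rexp

datatype bexp =
    NLess nexp nexp
  | RLess rexp rexp
  | BNot bexp
  | BAnd bexp bexp

datatype com =
    Skip
  | NAssign nat nexp nexp nexp
  | RAssign nat nexp nexp rexp
  | Flip nat nexp nexp rexp
  | Seq com com
  | Cond bexp com com
  | While bexp com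

primrec nval :: "nexp \<Rightarrow> state \<Rightarrow> nat" where
  "nval (NConst m) s = m"
| "nval (NCell a i j) s = nmem s (a, nval i s, nval j s)"
| "nval (NAdd x y) s = nval x s + nval y s"
| "nval (NSub x y) s = nval x s - nval y s"

primrec rval :: "rexp \<Rightarrow> state \<Rightarrow> real" where
  "rval (OfNat x) s = real (nval x s)"
| "rval (RCell a i j) s = rmem s (a, nval i s, nval j s)"
| "rval (RAdd x y) s = rval x s + rval y s"
| "rval (RSub x y) s = rval x s - rval y s"
| "rval (RMul x y) s = rval x s * rval y s"
| "rval (RDiv x y) s = rval x s / rval y s"

primrec bval :: "bexp \<Rightarrow> state \<Rightarrow> bool" where
  "bval (NLess x y) s \<longleftrightarrow> nval x s < nval y s"
| "bval (RLess x y) s \<longleftrightarrow> rval x s < rval y s"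
| "bval (BNot b) s \<longleftrightarrow> \<not> bval b s"
| "bval (BAnd b b') s \<longleftrightarrow> bval b s \<and> bval b' s"

definition nwrite :: "nat \<Rightarrow> nexp \<Rightarrow> nexp \<Rightarrow> nat \<Rightarrow> state \<Rightarrow> state" where
  "nwrite a i j x s = s\<lparr>nmem := (nmem s)((a, nval i s, nval j s) := x)\<rparr>"

definition rwrite :: "nat \<Rightarrow> nexp \<Rightarrow> nexp \<Rightarrow> real \<Rightarrow> state \<Rightarrow> state" where
  "rwrite a i j x s = s\<lparr>rmem := (rmem s)((a, nval i s, nval j s) := x)\<rparr>"

text \<open>
  One step of a program. \<open>Flip a i j p\<close> stores the outcome of a fresh independent coin with bias \<open>p\<close>,
  where \<open>bernoulli_pmf\<close> clips \<open>p\<close> to the interval from 0 to 1; this is the comparison of a uniform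
  random real in that interval with \<open>p\<close>. Evaluating an expression takes a number of operations
  bounded by the size of the program text, hence counting steps is counting operations up to a
  factor that depends on the program only.
\<close>

primrec step :: "com \<Rightarrow> state \<Rightarrow> (com \<times> state) pmf" where
  "step Skip s = return_pmf (Skip, s)"
| "step (NAssign a i j x) s = return_pmf (Skip, nwrite a i j (nval x s) s)"
| "step (RAssign a i j x) s = return_pmf (Skip, rwrite a i j (rval x s) s)"
| "step (Flip a i j p) s =
     map_pmf (\<lambda>b. (Skip, nwrite a i j (if b then 1 else 0) s)) (bernoulli_pmf (rval p s))"
| "step (Seq c1 c2) s =
     (if c1 = Skip then return_pmf (c2, s)
      else map_pmf (\<lambda>(c, s'). (Seq c c2, s')) (step c1 s))"
| "step (Cond b c1 c2) s = return_pmf (if bval b s then c1 else c2, s)"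
| "step (While b c) s = return_pmf (if bval b s then Seq c (While b c) else Skip, s)"

primrec run :: "nat \<Rightarrow> com \<Rightarrow> state \<Rightarrow> (com \<times> state) pmf" where
  "run 0 c s = return_pmf (c, s)"
| "run (Suc t) c s = bind_pmf (run t c s) (\<lambda>(c', s'). step c' s')"

definition halts_within :: "nat \<Rightarrow> com \<Rightarrow> state \<Rightarrow> bool" where
  "halts_within t c s \<longleftrightarrow> (\<forall>(c', s')\<in>set_pmf (run t c s). c' = Skip)"

section \<open>Algorithms for A-optimal design\<close>

text \<open>
  Input: \<open>n\<close>, \<open>d\<close>, \<open>k\<close> in the cells \<open>(0, 0, 0)\<close>, \<open>(0, 1, 0)\<close>, \<open>(0, 2, 0)\<close> of the memory for naturals;
  \<open>\<epsilon>\<close> in cell \<open>(0, 0, 0)\<close> and coordinate \<open>j\<close> of \<open>v i\<close> in cell \<open>(1, i, j)\<close> of the memory for reals;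
  all other cells are 0. Output: \<open>X i\<close> in cell \<open>(1, i, 0)\<close> of the memory for naturals.
\<close>

definition input_state :: "nat \<Rightarrow> nat \<Rightarrow> nat \<Rightarrow> real \<Rightarrow> (nat \<Rightarrow> real vec) \<Rightarrow> state" where
  "input_state n d k \<epsilon> v =
     \<lparr>nmem = (\<lambda>_. 0)((0, 0, 0) := n, (0, 1, 0) := d, (0, 2, 0) := k),
      rmem = (\<lambda>(a, i, j). if a = 0 \<and> i = 0 \<and> j = 0 then \<epsilon>
                          else if a = 1 \<and> i < n \<and> j < d then vec_index (v i) j
                          else 0)\<rparr>"

definition read_design :: "state \<Rightarrow> nat \<Rightarrow> nat" where
  "read_design s = (\<lambda>i. nmem s (1, i, 0))"

definition output_pmf ::
    "com \<Rightarrow> nat \<Rightarrow> nat \<Rightarrow> nat \<Rightarrow> nat \<Rightarrow> real \<Rightarrow> (nat \<Rightarrow> real vec) \<Rightarrow> (nat \<Rightarrow> nat) pmf" where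
  "output_pmf alg t n d k \<epsilon> v = map_pmf (\<lambda>(_, s). read_design s) (run t alg (input_state n d k \<epsilon> v))"

text \<open>On the given instance, every run of \<open>alg\<close> halts after at most \<open>t\<close> steps with a design of size
  \<open>k\<close>, and the expected value of the design is at most \<open>\<rho>\<close> times the optimum.\<close>

definition approximates ::
    "com \<Rightarrow> nat \<Rightarrow> real \<Rightarrow> nat \<Rightarrow> nat \<Rightarrow> nat \<Rightarrow> real \<Rightarrow> (nat \<Rightarrow> real vec) \<Rightarrow> bool" where
  "approximates alg t \<rho> n d k \<epsilon> v \<longleftrightarrow>
     halts_within t alg (input_state n d k \<epsilon> v) \<and>
     set_pmf (output_pmf alg t n d k \<epsilon> v) \<subseteq> designs n k \<and>
     (\<integral>\<^sup>+ X. a_value n d v X \<partial>measure_pmf (output_pmf alg t n d k \<epsilon> v)) \<le> ennreal \<rho> * OPT_rep n d k v"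

end

theory Submission
  imports Defs
begin

text \<open>
  A deterministic greedy algorithm attains the bound. For a design \<open>y\<close> of size \<open>s\<close> let \<open>G\<close> be the inverse of
  its information matrix, \<open>f = tr G\<close>, \<open>p\<^sub>i = v\<^sub>i \<bullet> G v\<^sub>i\<close> and \<open>q\<^sub>i = |G v\<^sub>i|\<^sup>2\<close>. By Sherman-Morrison, adding \<open>v\<^sub>i\<close> lowers \<open>f\<close>
  by \<open>q\<^sub>i / (1 + p\<^sub>i)\<close> and removing it raises \<open>f\<close> by \<open>q\<^sub>i / (1 - p\<^sub>i)\<close>.

  Growing: start from \<open>B\<close> copies of every vector, so that \<open>p\<^sub>i \<le> 1/B\<close> from then on. For every design \<open>X\<close> of size
  \<open>k\<close> with inverse \<open>H\<close>, Cauchy-Schwarz gives \<open>f\<^sup>2 \<le> (\<Sum>i. X\<^sub>i q\<^sub>i) tr H\<close>, so some \<open>q\<^sub>i\<close> is at least \<open>f\<^sup>2 / (k tr H)\<close>,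
  and \<open>1/f\<close> grows by at least \<open>B / ((B + 1) k tr H)\<close> per added vector. At size \<open>N = n B (B + 1)\<close> this yields
  \<open>N f \<le> (1 + 1/B)\<^sup>2 k tr H\<close>.

  Shrinking: since \<open>\<Sum>i. y\<^sub>i (1 - p\<^sub>i) = s - d\<close> and \<open>\<Sum>i. y\<^sub>i q\<^sub>i = f\<close>, some vector of the design has
  \<open>q\<^sub>i / (1 - p\<^sub>i) \<le> f / (s - d)\<close>; removing it does not increase \<open>(s - d + 1) f\<close>. At size \<open>k\<close> therefore
  \<open>(k - d + 1) f \<le> (1 + 1/B)\<^sup>2 k tr H\<close>, and \<open>B \<ge> 6 k / \<epsilon>\<close> suffices.
\<close>

section \<open>Rank-one updates of inverse information matrices\<close>

definition moment :: "nat \<Rightarrow> (nat \<Rightarrow> nat \<Rightarrow> real) \<Rightarrow> (nat \<Rightarrow> nat) \<Rightarrow> nat \<Rightarrow> nat \<Rightarrow> real" where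
  "moment m v y a b = (\<Sum>i<m. real (y i) * (v i a * v i b))"

text \<open>Matrices are index functions, so that a memory array can serve as one directly; only
  entries below \<open>d\<close> are constrained. A left inverse is enough, as it determines the
  inverse of a square matrix.\<close>

definition sym_inverse :: "nat \<Rightarrow> (nat \<Rightarrow> nat \<Rightarrow> real) \<Rightarrow> (nat \<Rightarrow> nat \<Rightarrow> real) \<Rightarrow> bool" where
  "sym_inverse d M G \<longleftrightarrow>
     (\<forall>a<d. \<forall>b<d. G a b = G b a) \<and>
     (\<forall>a<d. \<forall>c<d. (\<Sum>b<d. G a b * M b c) = (if a = c then 1 else 0))"

definition mv :: "nat \<Rightarrow> (nat \<Rightarrow> nat \<Rightarrow> real) \<Rightarrow> (nat \<Rightarrow> real) \<Rightarrow> nat \<Rightarrow> real" where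
  "mv d G u a = (\<Sum>b<d. G a b * u b)"

definition inner_d :: "nat \<Rightarrow> (nat \<Rightarrow> real) \<Rightarrow> (nat \<Rightarrow> real) \<Rightarrow> real" where
  "inner_d d u w = (\<Sum>a<d. u a * w a)"

definition tr :: "nat \<Rightarrow> (nat \<Rightarrow> nat \<Rightarrow> real) \<Rightarrow> real" where
  "tr d G = (\<Sum>a<d. G a a)"

text \<open>The leverage score of \<open>u\<close>; for the i-th vector, \<open>lev\<close> and
  \<open>sqn\<close> are the numbers \<open>p\<^sub>i\<close> and \<open>q\<^sub>i\<close> of the
  overview.\<close>

abbreviation lev :: "nat \<Rightarrow> (nat \<Rightarrow> nat \<Rightarrow> real) \<Rightarrow> (nat \<Rightarrow> real) \<Rightarrow> real" where
  "lev d G u \<equiv> inner_d d u (mv d G u)"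

abbreviation sqn :: "nat \<Rightarrow> (nat \<Rightarrow> nat \<Rightarrow> real) \<Rightarrow> (nat \<Rightarrow> real) \<Rightarrow> real" where
  "sqn d G u \<equiv> inner_d d (mv d G u) (mv d G u)"

text \<open>The Sherman-Morrison formula for the inverse of \<open>M + c u u^T\<close>. The
  algorithm uses \<open>c = B\<close> when it loads the vectors, \<open>c = 1\<close> when it grows
  and \<open>c = -1\<close> whenever it removes a row.\<close>

definition rank1_update ::
    "nat \<Rightarrow> (nat \<Rightarrow> nat \<Rightarrow> real) \<Rightarrow> (nat \<Rightarrow> real) \<Rightarrow> real \<Rightarrow> nat \<Rightarrow> nat \<Rightarrow> real" where
  "rank1_update d G u c a b = G a b - c * (mv d G u a * mv d G u b) / (1 + c * lev d G u)"

lemma sum_scaled_inner_d: "(\<Sum>b<d. c * u b * w b) = c * inner_d d u w"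
  by (simp add: inner_d_def sum_distrib_left mult.assoc)

text \<open>The change is stated over the reals so that a negative \<open>c\<close> describes a
  removal although multiplicities are natural numbers.\<close>

lemma moment_update:
  assumes "j < m" and "real (y' j) = real (y j) + c" and "\<And>i. i \<noteq> j \<Longrightarrow> y' i = y i"
  shows "moment m v y' a b = moment m v y a b + c * (v j a * v j b)"
proof -
  have "moment m v y' a b = (\<Sum>i<m. real (y i) * (v i a * v i b) + (if i = j then c * (v j a * v j b) else 0))"
    unfolding moment_def using assms by (intro sum.cong) (auto simp: algebra_simps)
  then show ?thesis using assms(1) by (simp add: sum.distrib moment_def)
qed

text \<open>With \<open>g = G u\<close>, symmetry of \<open>G\<close> gives
  \<open>g^T M = u^T\<close>. Multiplying the formula by \<open>M + c u u^T\<close> leaves the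
  identity plus a multiple of \<open>g u^T\<close> whose coefficient is
  \<open>c - r (1 + c p) = 0\<close>, where \<open>p\<close> is the leverage of
  \<open>u\<close>.\<close>

lemma sherman_morrison:
  assumes inv: "sym_inverse d M G" and nz: "1 + c * lev d G u \<noteq> 0"
    and M': "\<And>a b. a < d \<Longrightarrow> b < d \<Longrightarrow> M' a b = M a b + c * (u a * u b)"
  shows "sym_inverse d M' (rank1_update d G u c)"
proof -
  have sym: "G a b = G b a" if "a < d" "b < d" for a b using inv that unfolding sym_inverse_def by auto
  have id: "(\<Sum>b<d. G a b * M b e) = (if a = e then 1 else 0)" if "a < d" "e < d" for a e
    using inv that unfolding sym_inverse_def by auto
  define g where "g = mv d G u"
  define r where "r = c / (1 + c * lev d G u)"
  have r: "r * (1 + c * lev d G u) = c" using nz unfolding r_def by simp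
  have gM: "(\<Sum>b<d. g b * M b e) = u e" if e: "e < d" for e
  proof -
    have "(\<Sum>b<d. g b * M b e) = (\<Sum>b<d. \<Sum>x<d. G x b * u x * M b e)"
      unfolding g_def mv_def sum_distrib_right by (intro sum.cong) (auto simp: sym)
    also have "\<dots> = (\<Sum>x<d. \<Sum>b<d. G x b * u x * M b e)" by (rule sum.swap)
    also have "\<dots> = (\<Sum>x<d. u x * (\<Sum>b<d. G x b * M b e))"
      unfolding sum_distrib_left by (intro sum.cong) (auto simp: algebra_simps)
    also have "\<dots> = (\<Sum>x<d. if x = e then u x else 0)" using e by (intro sum.cong) (auto simp: id)
    finally show ?thesis using e by simp
  qed
  have "(\<Sum>b<d. rank1_update d G u c a b * M' b e) = (if a = e then 1 else 0)" if a: "a < d" and e: "e < d" for a e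
  proof -
    have "(\<Sum>b<d. rank1_update d G u c a b * M' b e)
        = (\<Sum>b<d. G a b * M b e + c * u e * (G a b * u b) - r * g a * (g b * M b e) - r * g a * c * u e * (u b * g b))"
      using e by (intro sum.cong) (auto simp: M' rank1_update_def r_def g_def algebra_simps add_divide_distrib diff_divide_distrib)
    also have "\<dots> = (if a = e then 1 else 0) + c * u e * g a - r * g a * u e - r * g a * c * u e * lev d G u"
      using a e by (simp add: sum.distrib sum_subtractf sum_distrib_left[symmetric] id gM)
        (simp add: g_def mv_def inner_d_def)
    also have "\<dots> = (if a = e then 1 else 0) + g a * u e * (c - r * (1 + c * lev d G u))"
      by (simp add: algebra_simps)
    finally show ?thesis unfolding r by simp
  qed
  then show ?thesis unfolding sym_inverse_def by (auto simp: rank1_update_def sym mult.commute)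
qed

lemma tr_rank1_update:
  "tr d (rank1_update d G u c) = tr d G - c * sqn d G u / (1 + c * lev d G u)"
  unfolding tr_def rank1_update_def inner_d_def
  by (simp add: sum_subtractf sum_distrib_left sum_divide_distrib)

section \<open>Trace identities and leverage bounds for a design and its inverse\<close>

context
  fixes d m :: nat and v :: "nat \<Rightarrow> nat \<Rightarrow> real" and y :: "nat \<Rightarrow> nat" and G :: "nat \<Rightarrow> nat \<Rightarrow> real"
  assumes inv: "sym_inverse d (moment m v y) G"
begin

text \<open>This is \<open>M (G u) = u\<close> expanded over the rows of the design; symmetry of
  \<open>G\<close> turns the left inverse into a right inverse.\<close>

lemma sym_inverse_reconstruct:
  assumes b: "b < d"
  shows "(\<Sum>i<m. real (y i) * inner_d d (v i) (mv d G u) * v i b) = u b"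
proof -
  have sym: "G a b = G b a" if "a < d" "b < d" for a b using inv that unfolding sym_inverse_def by auto
  have "(\<Sum>i<m. real (y i) * inner_d d (v i) (mv d G u) * v i b)
     = (\<Sum>i<m. \<Sum>a<d. mv d G u a * (real (y i) * (v i a * v i b)))"
    unfolding inner_d_def sum_distrib_left sum_distrib_right
    by (intro sum.cong) (auto simp: algebra_simps)
  also have "\<dots> = (\<Sum>a<d. \<Sum>i<m. mv d G u a * (real (y i) * (v i a * v i b)))" by (rule sum.swap)
  also have "\<dots> = (\<Sum>a<d. mv d G u a * moment m v y a b)"
    unfolding moment_def by (simp add: sum_distrib_left)
  also have "\<dots> = (\<Sum>a<d. \<Sum>x<d. G x a * u x * moment m v y a b)"
    unfolding mv_def sum_distrib_right by (intro sum.cong) (auto simp: sym)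
  also have "\<dots> = (\<Sum>x<d. \<Sum>a<d. G x a * u x * moment m v y a b)" by (rule sum.swap)
  also have "\<dots> = (\<Sum>x<d. u x * (\<Sum>a<d. G x a * moment m v y a b))"
    unfolding sum_distrib_left by (intro sum.cong) (auto simp: algebra_simps)
  also have "\<dots> = (\<Sum>x<d. if x = b then u x else 0)"
    using inv b unfolding sym_inverse_def by (intro sum.cong) auto
  finally show ?thesis using b by simp
qed

text \<open>By the expansion of \<open>u\<close>, the quadratic form \<open>u . G u\<close> equals
  \<open>(G u)^T M (G u)\<close>, a weighted sum of squares. Positivity of \<open>G\<close> thus
  comes without any spectral argument.\<close>

lemma lev_eq: "lev d G u = (\<Sum>i<m. real (y i) * (inner_d d (v i) (mv d G u))\<^sup>2)"
proof -
  have "lev d G u = (\<Sum>b<d. \<Sum>i<m. real (y i) * inner_d d (v i) (mv d G u) * v i b * mv d G u b)"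
    unfolding inner_d_def[of d u] sum_distrib_right[symmetric]
    by (intro sum.cong) (auto simp: sym_inverse_reconstruct)
  also have "\<dots> = (\<Sum>i<m. \<Sum>b<d. real (y i) * inner_d d (v i) (mv d G u) * v i b * mv d G u b)"
    by (rule sum.swap)
  also have "\<dots> = (\<Sum>i<m. real (y i) * (inner_d d (v i) (mv d G u))\<^sup>2)"
    unfolding sum_scaled_inner_d by (simp add: power2_eq_square mult.assoc)
  finally show ?thesis .
qed

lemma lev_nonneg: "0 \<le> lev d G u"
  unfolding lev_eq by (intro sum_nonneg) auto

text \<open>In \<open>lev_eq\<close> for the row \<open>v j\<close> itself, the j-th summand is
  \<open>y j\<close> times the squared leverage; it is at most the whole sum, which is the
  leverage.\<close>

lemma lev_le:
  assumes "j < m"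
  shows "real (y j) * lev d G (v j) \<le> 1"
proof -
  have "real (y j) * (lev d G (v j))\<^sup>2 \<le> (\<Sum>i<m. real (y i) * (inner_d d (v i) (mv d G (v j)))\<^sup>2)"
    by (rule member_le_sum[where f = "\<lambda>i. real (y i) * (inner_d d (v i) (mv d G (v j)))\<^sup>2"]) (use assms in auto)
  also have "\<dots> = lev d G (v j)" by (rule lev_eq[symmetric])
  finally have le: "real (y j) * (lev d G (v j))\<^sup>2 \<le> lev d G (v j)" .
  show ?thesis
  proof (cases "lev d G (v j) = 0")
    case False
    then have pos: "0 < lev d G (v j)" using lev_nonneg[of "v j"] by simp
    have "(real (y j) * lev d G (v j)) * lev d G (v j) \<le> 1 * lev d G (v j)"
      using le by (simp add: power2_eq_square mult.assoc)
    then show ?thesis using pos by (rule mult_right_le_imp_le)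
  qed simp
qed

text \<open>Both sides are the trace of \<open>G M\<close>, the identity matrix of size
  \<open>d\<close>.\<close>

lemma sum_lev: "(\<Sum>i<m. real (y i) * lev d G (v i)) = real d"
proof -
  have "(\<Sum>i<m. real (y i) * lev d G (v i))
     = (\<Sum>i<m. \<Sum>a<d. \<Sum>b<d. G a b * (real (y i) * (v i b * v i a)))"
    unfolding inner_d_def mv_def sum_distrib_left by (intro sum.cong) (auto simp: algebra_simps)
  also have "\<dots> = (\<Sum>a<d. \<Sum>i<m. \<Sum>b<d. G a b * (real (y i) * (v i b * v i a)))" by (rule sum.swap)
  also have "\<dots> = (\<Sum>a<d. \<Sum>b<d. G a b * moment m v y b a)"
    unfolding moment_def sum_distrib_left by (rule sum.cong[OF refl], rule sum.swap)
  also have "\<dots> = (\<Sum>a<d. 1)"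
    using inv unfolding sym_inverse_def by (intro sum.cong) auto
  finally show ?thesis by simp
qed

text \<open>The sum is the trace of \<open>H^T G M\<close>, and \<open>G M\<close> is the identity.
  The matrix \<open>H\<close> is arbitrary: \<open>H = G\<close> evaluates the weighted total of the
  \<open>q\<^sub>i\<close>, and another inverse supplies the mixed term of a Cauchy-Schwarz
  estimate.\<close>

lemma sum_inner_mv: "(\<Sum>i<m. real (y i) * inner_d d (mv d H (v i)) (mv d G (v i))) = tr d H"
proof -
  have "(\<Sum>i<m. real (y i) * inner_d d (mv d H (v i)) (mv d G (v i)))
     = (\<Sum>i<m. \<Sum>a<d. \<Sum>b<d. \<Sum>e<d. H a b * (G a e * (real (y i) * (v i e * v i b))))"
    unfolding inner_d_def mv_def sum_product unfolding sum_distrib_left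
    by (intro sum.cong) (auto simp: algebra_simps)
  also have "\<dots> = (\<Sum>a<d. \<Sum>i<m. \<Sum>b<d. \<Sum>e<d. H a b * (G a e * (real (y i) * (v i e * v i b))))"
    by (rule sum.swap)
  also have "\<dots> = (\<Sum>a<d. \<Sum>b<d. \<Sum>i<m. \<Sum>e<d. H a b * (G a e * (real (y i) * (v i e * v i b))))"
    by (rule sum.cong[OF refl], rule sum.swap)
  also have "\<dots> = (\<Sum>a<d. \<Sum>b<d. \<Sum>e<d. \<Sum>i<m. H a b * (G a e * (real (y i) * (v i e * v i b))))"
    by (rule sum.cong[OF refl], rule sum.cong[OF refl], rule sum.swap)
  also have "\<dots> = (\<Sum>a<d. \<Sum>b<d. H a b * (\<Sum>e<d. G a e * moment m v y e b))"
    unfolding moment_def sum_distrib_left ..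
  also have "\<dots> = (\<Sum>a<d. \<Sum>b<d. if b = a then H a b else 0)"
    using inv unfolding sym_inverse_def by (intro sum.cong) auto
  finally show ?thesis by (simp add: tr_def)
qed

lemma sqn_nonneg: "0 \<le> sqn d G u"
  unfolding inner_d_def by (intro sum_nonneg) auto

lemma tr_nonneg: "0 \<le> tr d G"
  unfolding sum_inner_mv[of G, symmetric] by (intro sum_nonneg mult_nonneg_nonneg sqn_nonneg) auto

text \<open>A vanishing trace would force \<open>G\<close> to annihilate every row in use, hence all
  their leverages to vanish, while the weighted leverages add up to \<open>d\<close>.\<close>

lemma tr_pos:
  assumes "0 < d"
  shows "0 < tr d G"
proof (rule ccontr)
  assume "\<not> 0 < tr d G"
  then have z: "(\<Sum>i<m. real (y i) * sqn d G (v i)) = 0"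
    using tr_nonneg sum_inner_mv[of G] by simp
  have "real (y i) * lev d G (v i) = 0" if i: "i < m" for i
  proof -
    have "\<forall>i\<in>{..<m}. real (y i) * sqn d G (v i) = 0"
      using z by (subst (asm) sum_nonneg_eq_0_iff) (auto intro!: mult_nonneg_nonneg sqn_nonneg)
    then have "y i = 0 \<or> sqn d G (v i) = 0" using i by auto
    moreover have "lev d G (v i) = 0" if "sqn d G (v i) = 0"
    proof -
      have "\<forall>a\<in>{..<d}. mv d G (v i) a * mv d G (v i) a = 0"
        using that unfolding inner_d_def by (subst (asm) sum_nonneg_eq_0_iff) auto
      then show ?thesis unfolding inner_d_def by (intro sum.neutral) auto
    qed
    ultimately show ?thesis by auto
  qed
  then have "(\<Sum>i<m. real (y i) * lev d G (v i)) = 0" by (intro sum.neutral) auto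
  then show False using sum_lev assms by simp
qed

text \<open>The nonnegative sum of \<open>y i |H v_i - l G v_i|^2\<close> is a quadratic polynomial
  in \<open>l\<close>, whose mixed and leading coefficients are traces by
  \<open>sum_inner_mv\<close>; its minimizer \<open>l = tr H / tr G\<close> gives the inequality. In
  the application \<open>G\<close> belongs to the comparison design and \<open>H\<close> to the
  current one.\<close>

lemma cauchy_schwarz_tr:
  "(tr d H)\<^sup>2 \<le> (\<Sum>i<m. real (y i) * sqn d H (v i)) * tr d G"
proof -
  define Q where "Q = (\<Sum>i<m. real (y i) * sqn d H (v i))"
  have key: "0 \<le> Q - 2 * l * tr d H + l\<^sup>2 * tr d G" for l
  proof -
    have "Q - 2 * l * tr d H + l\<^sup>2 * tr d G
      = (\<Sum>i<m. real (y i) * (\<Sum>a<d. (mv d H (v i) a - l * mv d G (v i) a)\<^sup>2))"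
      unfolding Q_def sum_inner_mv[symmetric] inner_d_def sum_distrib_left sum_subtractf[symmetric] sum.distrib[symmetric]
      by (intro sum.cong) (auto simp: algebra_simps power2_eq_square)
    also have "\<dots> \<ge> 0" by (intro sum_nonneg mult_nonneg_nonneg) auto
    finally show ?thesis .
  qed
  show ?thesis
  proof (cases "tr d G = 0")
    case True
    have "d = 0" using tr_pos True by (cases d) auto
    then show ?thesis by (simp add: tr_def)
  next
    case False
    then have pos: "0 < tr d G" using tr_nonneg by simp
    have "0 \<le> tr d G * (Q - 2 * (tr d H / tr d G) * tr d H + (tr d H / tr d G)\<^sup>2 * tr d G)"
      using key[of "tr d H / tr d G"] pos by simp
    also have "\<dots> = Q * tr d G - (tr d H)\<^sup>2"
      using pos by (simp add: field_simps power2_eq_square)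
    finally show ?thesis unfolding Q_def by simp
  qed
qed

text \<open>An averaging argument: the weights \<open>y i (1 - p_i)\<close> add up to
  \<open>s - d\<close> and the numbers \<open>y i q_i\<close> to \<open>f\<close>, so the ratio
  \<open>q_i / (1 - p_i)\<close> cannot exceed \<open>f / (s - d)\<close> on all rows of positive
  weight.\<close>

lemma exists_cheap_removal:
  assumes "0 < d" and s: "d < (\<Sum>i<m. y i)"
  shows "\<exists>i<m. 0 < y i \<and> 0 < 1 - lev d G (v i) \<and>
           sqn d G (v i) / (1 - lev d G (v i)) \<le> tr d G / (real (\<Sum>i<m. y i) - real d)"
proof (rule ccontr)
  assume no: "\<not> ?thesis"
  define r where "r = tr d G / (real (\<Sum>i<m. y i) - real d)"
  have rpos: "0 < r" using tr_pos[OF assms(1)] s unfolding r_def by (simp del: of_nat_sum)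
  have le1: "lev d G (v i) \<le> 1" if "i < m" "0 < y i" for i
  proof -
    have "1 * lev d G (v i) \<le> real (y i) * lev d G (v i)"
      using that lev_nonneg by (intro mult_right_mono) auto
    then show ?thesis using lev_le[OF that(1)] by simp
  qed
  have strict: "r * (1 - lev d G (v i)) < sqn d G (v i)" if "i < m" "0 < y i" "lev d G (v i) < 1" for i
  proof -
    have "\<not> sqn d G (v i) / (1 - lev d G (v i)) \<le> r" using no that unfolding r_def by auto
    then show ?thesis using that by (simp add: field_simps)
  qed
  \<comment> \<open>A row of leverage 1 makes the left side zero, so no division is involved
    there.\<close>
  have weak: "real (y i) * (r * (1 - lev d G (v i))) \<le> real (y i) * sqn d G (v i)" if "i < m" for i
    using strict[OF that] le1[OF that] sqn_nonneg[of "v i"] rpos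
    by (cases "y i = 0"; cases "lev d G (v i) < 1") (auto intro!: mult_left_mono intro: less_imp_le)
  have tot: "(\<Sum>i<m. real (y i) * (1 - lev d G (v i))) = real (\<Sum>i<m. y i) - real d"
    by (simp add: right_diff_distrib sum_subtractf sum_lev)
  \<comment> \<open>Otherwise the weights could not add up to \<open>s - d > 0\<close>; such a row
    makes the summed inequality strict.\<close>
  have "\<exists>i<m. 0 < y i \<and> lev d G (v i) < 1"
  proof (rule ccontr)
    assume "\<not> ?thesis"
    then have "(\<Sum>i<m. real (y i) * (1 - lev d G (v i))) \<le> 0"
      by (intro sum_nonpos) (force simp: mult_le_0_iff)
    then show False using tot s by (simp flip: of_nat_sum)
  qed
  then obtain i where i: "i < m" "0 < y i" "lev d G (v i) < 1" by auto
  have "(\<Sum>i<m. real (y i) * (r * (1 - lev d G (v i)))) < (\<Sum>i<m. real (y i) * sqn d G (v i))"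
    by (rule sum_strict_mono_ex1)
      (use weak strict[OF i] i in \<open>auto intro!: bexI[of _ i] mult_strict_left_mono\<close>)
  also have "\<dots> = tr d G" by (rule sum_inner_mv)
  finally have "r * (\<Sum>i<m. real (y i) * (1 - lev d G (v i))) < tr d G"
    by (simp add: sum_distrib_left algebra_simps)
  then show False unfolding tot r_def using s by (simp del: of_nat_sum)
qed

end

text \<open>The design \<open>X\<close> enters only through an average of the
  \<open>q\<^sub>i\<close>; the gain on the right does not mention it. One greedy choice can
  therefore compete with all designs \<open>X\<close> at once.\<close>

lemma exists_good_addition:
  assumes G: "sym_inverse d (moment n v y) G" and H: "sym_inverse d (moment n v X) H"
    and y: "\<And>i. i < n \<Longrightarrow> B \<le> y i" and B: "0 < B" and d: "0 < d"
    and X: "(\<Sum>i<n. X i) = k" and k: "0 < k"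
  shows "\<exists>i<n. real B / (real B + 1) * (tr d G)\<^sup>2 / (real k * tr d H) \<le> sqn d G (v i) / (1 + lev d G (v i))"
proof -
  define r where "r = (tr d G)\<^sup>2 / (real k * tr d H)"
  have h: "0 < tr d H" by (rule tr_pos[OF H d])
  have "\<exists>i<n. r \<le> sqn d G (v i)"
  proof (rule ccontr)
    assume "\<not> ?thesis"
    then have lt: "sqn d G (v i) < r" if "i < n" for i using that by auto
    obtain i where "i < n" "X i \<noteq> 0" using X k by (metis lessThan_iff sum.neutral less_irrefl)
    then have "(\<Sum>i<n. real (X i) * sqn d G (v i)) < (\<Sum>i<n. real (X i) * r)"
      by (intro sum_strict_mono_ex1)
        (use lt in \<open>auto intro!: bexI[of _ i] mult_left_mono mult_strict_left_mono intro: less_imp_le\<close>)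
    also have "\<dots> = real k * r" unfolding X[symmetric] by (simp add: sum_distrib_right)
    finally have "(\<Sum>i<n. real (X i) * sqn d G (v i)) * tr d H < real k * r * tr d H"
      using h by simp
    also have "\<dots> = (tr d G)\<^sup>2" using h k unfolding r_def by simp
    finally show False using cauchy_schwarz_tr[OF H, of G] by simp
  qed
  then obtain i where i: "i < n" "r \<le> sqn d G (v i)" by auto
  have l0: "0 \<le> lev d G (v i)" by (rule lev_nonneg[OF G])
  \<comment> \<open>Every row has multiplicity at least \<open>B\<close>, so its leverage is at most
    \<open>1 / B\<close>.\<close>
  have "real B * lev d G (v i) \<le> real (y i) * lev d G (v i)"
    using y[OF i(1)] l0 by (intro mult_right_mono) auto
  also have "\<dots> \<le> 1" by (rule lev_le[OF G i(1)])
  finally have l1: "real B * (1 + lev d G (v i)) \<le> real B + 1" by (simp add: algebra_simps)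
  have "real B / (real B + 1) \<le> 1 / (1 + lev d G (v i))" using l0 l1 B by (simp add: field_simps)
  moreover have "0 \<le> r" unfolding r_def using h by simp
  ultimately have "real B / (real B + 1) * r \<le> 1 / (1 + lev d G (v i)) * sqn d G (v i)"
    using i(2) l0 by (intro mult_mono) auto
  then show ?thesis using i(1) unfolding r_def by auto
qed

text \<open>A division-free form of the claim that \<open>1 / f\<close> grows by
  \<open>c0 / K\<close> per step. For \<open>m = 0\<close> the premise is trivial, so the initial
  trace does not matter.\<close>

lemma greedy_addition_recurrence:
  fixes f f' K c0 m :: real
  assumes K: "0 < K" and c0: "0 \<le> c0" and f: "0 \<le> f" and m: "0 \<le> m"
    and old: "m * c0 * f \<le> K" and new: "f' \<le> f - c0 * f\<^sup>2 / K"
  shows "(m + 1) * c0 * f' \<le> K"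
proof -
  define z where "z = c0 * f / K"
  have z: "0 \<le> z" unfolding z_def using assms by simp
  have mz: "m * z \<le> 1" unfolding z_def using old K by (simp add: field_simps)
  have "(m + 1) * z * (1 - z) \<le> 1"
  proof (cases "z \<le> 1")
    case True
    \<comment> \<open>Together with the summand \<open>z (1 - z)\<close> this bounds the product by
      \<open>(1 + z) (1 - z)\<close>.\<close>
    have "m * z * (1 - z) \<le> 1 * (1 - z)" using mz True by (intro mult_right_mono) auto
    then have "(m + 1) * z * (1 - z) \<le> 1 - z\<^sup>2" by (simp add: algebra_simps power2_eq_square)
    also have "\<dots> \<le> 1" by simp
    finally show ?thesis .
  next
    case False
    then have "(m + 1) * z * (1 - z) \<le> 0" using z m by (intro mult_nonneg_nonpos) auto
    then show ?thesis by simp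
  qed
  then have *: "K * ((m + 1) * z * (1 - z)) \<le> K" using K by simp
  have "(m + 1) * c0 * f' \<le> (m + 1) * c0 * (f - c0 * f\<^sup>2 / K)"
    using new m c0 by (intro mult_left_mono) auto
  also have "\<dots> = K * ((m + 1) * z * (1 - z))"
    unfolding z_def using K by (simp add: field_simps power2_eq_square)
  finally show ?thesis using * by simp
qed

text \<open>This makes the denominator positive when a unit row is removed. If the leverage were 1,
  the row's own summand would exhaust \<open>lev_eq\<close>, so \<open>G v_j\<close> would be
  orthogonal to the first \<open>n\<close> rows; these separate vectors, so it would vanish.\<close>

lemma unit_lev_less_1:
  assumes inv: "sym_inverse d (moment m v y) G" and j: "j < m" "y j = 1" and n: "n \<le> j"
    and y: "\<And>i. i < n \<Longrightarrow> 0 < y i"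
    and span: "\<And>w. (\<And>i. i < n \<Longrightarrow> inner_d d (v i) w = 0) \<Longrightarrow> (\<And>a. a < d \<Longrightarrow> w a = 0)"
  shows "lev d G (v j) < 1"
proof (rule ccontr)
  assume "\<not> ?thesis"
  then have one: "lev d G (v j) = 1" using lev_le[OF inv j(1)] j(2) by simp
  let ?t = "\<lambda>i. real (y i) * (inner_d d (v i) (mv d G (v j)))\<^sup>2"
  have "(\<Sum>i<m. ?t i) = 1" using lev_eq[OF inv, of "v j"] one by simp
  moreover have "(\<Sum>i<m. ?t i) = ?t j + (\<Sum>i\<in>{..<m} - {j}. ?t i)"
    using j(1) by (intro sum.remove) auto
  ultimately have "(\<Sum>i\<in>{..<m} - {j}. ?t i) = 0" using one j(2) by simp
  then have z: "\<forall>i\<in>{..<m} - {j}. ?t i = 0" by (subst (asm) sum_nonneg_eq_0_iff) auto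
  have "inner_d d (v i) (mv d G (v j)) = 0" if "i < n" for i
    using z[rule_format, of i] that n j(1) y[OF that] by auto
  then have "mv d G (v j) a = 0" if "a < d" for a using span that by blast
  then have "lev d G (v j) = 0" unfolding inner_d_def by (intro sum.neutral) auto
  then show False using one by simp
qed

lemma sym_inverse_cong:
  assumes "sym_inverse d M G" and "\<And>a b. a < d \<Longrightarrow> b < d \<Longrightarrow> M' a b = M a b"
    and "\<And>a b. a < d \<Longrightarrow> b < d \<Longrightarrow> G' a b = G a b"
  shows "sym_inverse d M' G'"
  using assms unfolding sym_inverse_def by auto

lemma tr_cong: "(\<And>a b. a < d \<Longrightarrow> b < d \<Longrightarrow> G' a b = G a b) \<Longrightarrow> tr d G' = tr d G"
  unfolding tr_def by (intro sum.cong) auto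

lemma overhead_square_le:
  fixes B :: nat
  assumes "0 < B"
  shows "((real B + 1) / real B)\<^sup>2 \<le> 1 + 3 / real B"
proof -
  have b: "1 \<le> real B" using assms by simp
  have "((real B + 1) / real B)\<^sup>2 = 1 + 2 / real B + 1 / real B * (1 / real B)"
    using b by (simp add: field_simps power2_eq_square)
  also have "1 / real B * (1 / real B) \<le> 1 / real B * 1" using b by (intro mult_left_mono) auto
  finally show ?thesis by simp
qed

text \<open>A one-sided inverse of a square matrix makes it a unit, which excludes
  \<open>None\<close>; the rest is uniqueness of inverses. This connects coordinate inverses with
  \<open>mat_inverse\<close>.\<close>

lemma mat_inverse_unique:
  assumes A: "A \<in> carrier_mat m m" and C: "C \<in> carrier_mat m m" and CA: "C * A = 1\<^sub>m m"
  shows "mat_inverse A = Some (C :: real mat)"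
proof (cases "mat_inverse A")
  case None
  have "A * C = 1\<^sub>m m" by (rule mat_mult_left_right_inverse[OF C A CA])
  then have "A \<in> Units (ring_mat TYPE(real) m ())"
    using A C CA unfolding Units_def ring_mat_def by auto
  then show ?thesis using mat_inverse(1)[OF A None, where b = "()"] by blast
next
  case (Some D)
  then have D: "A * D = 1\<^sub>m m" "D \<in> carrier_mat m m" using mat_inverse(2)[OF A] by auto
  have "C = C * (A * D)" using D C by simp
  also have "\<dots> = (C * A) * D" using A C D by (simp add: assoc_mult_mat)
  also have "\<dots> = D" using CA D by simp
  finally show ?thesis using Some by simp
qed

section \<open>Timed Hoare logic for deterministic programs\<close>

primrec reach :: "nat \<Rightarrow> com \<Rightarrow> state \<Rightarrow> state \<Rightarrow> bool" where
  "reach 0 c s s' \<longleftrightarrow> c = Skip \<and> s = s'"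
| "reach (Suc t) c s s' \<longleftrightarrow> (\<exists>c1 s1. step c s = return_pmf (c1, s1) \<and> reach t c1 s1 s')"

text \<open>\<open>run\<close> appends a step at the end, whereas \<open>reach\<close> unfolds the
  first step.\<close>

lemma run_Suc_left: "run (Suc t) c s = bind_pmf (step c s) (\<lambda>(c', s'). run t c' s')"
proof (induction t)
  case 0
  have "run (Suc 0) c s = bind_pmf (step c s) return_pmf"
    by (simp add: bind_return_pmf bind_return_pmf')
  moreover have "(\<lambda>(c', s'). run 0 c' s') = return_pmf" by (simp add: fun_eq_iff split: prod.split)
  ultimately show ?case by simp
next
  case (Suc t)
  have "run (Suc (Suc t)) c s = bind_pmf (run (Suc t) c s) (\<lambda>(c', s'). step c' s')" by simp
  also have "\<dots> = bind_pmf (step c s) (\<lambda>(c', s'). run (Suc t) c' s')"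
    unfolding Suc by (simp add: bind_assoc_pmf case_prod_unfold)
  finally show ?case .
qed

text \<open>The return to the probabilistic semantics: a deterministic execution yields a point
  mass.\<close>

lemma reach_run: "reach t c s s' \<Longrightarrow> run t c s = return_pmf (Skip, s')"
  by (induction t arbitrary: c s) (auto simp: run_Suc_left bind_return_pmf simp del: run.simps(2))

lemma reach_Skip: "reach t Skip s s' \<longleftrightarrow> s' = s"
  by (induction t) auto

text \<open>\<open>Skip\<close> steps to itself, so a finished run can idle and \<open>reach\<close>
  bounds the running time rather than fixing it.\<close>

lemma reach_mono:
  assumes "reach t c s s'" and "t \<le> t'"
  shows "reach t' c s s'"
  using assms
proof (induction t arbitrary: c s t')
  case 0
  then show ?case by (auto simp: reach_Skip)
next
  case (Suc t)
  then obtain u where "t' = Suc u" "t \<le> u" by (cases t') auto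
  with Suc show ?case by auto
qed

text \<open>The extra step discards the finished first command. As \<open>t1\<close> is only a
  bound, that command may be \<open>Skip\<close> before the time is used up, hence the case
  distinction.\<close>

lemma reach_Seq:
  assumes "reach t1 c1 s s1" and "reach t2 c2 s1 s2"
  shows "reach (t1 + t2 + 1) (Seq c1 c2) s s2"
  using assms(1)
proof (induction t1 arbitrary: c1 s)
  case 0
  then show ?case using assms(2) by auto
next
  case (Suc t)
  show ?case
  proof (cases "c1 = Skip")
    case True
    then have "s1 = s" using Suc.prems by (simp add: reach_Skip)
    then have "reach (Suc t2) (Seq c1 c2) s s2" using True assms(2) by auto
    then show ?thesis by (rule reach_mono) simp
  next
    case False
    obtain c' s' where st: "step c1 s = return_pmf (c', s')" "reach t c' s' s1" using Suc.prems by auto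
    then show ?thesis using False Suc.IH[OF st(2)] by auto
  qed
qed

lemma reach_NAssign: "reach 1 (NAssign a i j x) s (nwrite a i j (nval x s) s)"
  by simp

lemma reach_RAssign: "reach 1 (RAssign a i j x) s (rwrite a i j (rval x s) s)"
  by simp

lemma reach_Cond:
  assumes "reach t (if bval b s then c1 else c2) s s'"
  shows "reach (t + 1) (Cond b c1 c2) s s'"
  using assms by auto

lemma reach_While_False: "\<not> bval b s \<Longrightarrow> reach 1 (While b c) s s"
  by simp

text \<open>One of the two extra steps unfolds the loop, the other drops the finished body.\<close>

lemma reach_While_True:
  assumes "bval b s" and "reach t1 c s s1" and "reach t2 (While b c) s1 s2"
  shows "reach (t1 + t2 + 2) (While b c) s s2"
  using assms reach_Seq[OF assms(2,3)] by auto

section \<open>Total-correctness triples with time bounds\<close>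

definition hoare :: "(state \<Rightarrow> bool) \<Rightarrow> nat \<Rightarrow> com \<Rightarrow> (state \<Rightarrow> bool) \<Rightarrow> bool" where
  "hoare P t c Q \<longleftrightarrow> (\<forall>s. P s \<longrightarrow> (\<exists>s'. reach t c s s' \<and> Q s'))"

lemma hoare_Seq:
  assumes "hoare P t1 c1 Q" and "hoare Q t2 c2 R"
  shows "hoare P (t1 + t2 + 1) (Seq c1 c2) R"
  using assms reach_Seq unfolding hoare_def by blast

lemma hoare_conseq:
  assumes "hoare P t c Q" and "\<And>s. P' s \<Longrightarrow> P s" and "\<And>s. Q s \<Longrightarrow> Q' s" and "t \<le> t'"
  shows "hoare P' t' c Q'"
  using assms reach_mono unfolding hoare_def by meson

lemma hoare_NAssign:
  assumes "\<And>s. P s \<Longrightarrow> Q (nwrite a i j (nval x s) s)"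
  shows "hoare P 1 (NAssign a i j x) Q"
  using assms reach_NAssign unfolding hoare_def by blast

lemma hoare_RAssign:
  assumes "\<And>s. P s \<Longrightarrow> Q (rwrite a i j (rval x s) s)"
  shows "hoare P 1 (RAssign a i j x) Q"
  using assms reach_RAssign unfolding hoare_def by blast

lemma hoare_Cond:
  assumes "hoare (\<lambda>s. P s \<and> bval b s) t c1 Q" and "\<And>s. P s \<Longrightarrow> \<not> bval b s \<Longrightarrow> Q s"
  shows "hoare P (t + 1) (Cond b c1 Skip) Q"
  unfolding hoare_def
proof (intro allI impI)
  fix s assume P: "P s"
  show "\<exists>s'. reach (t + 1) (Cond b c1 Skip) s s' \<and> Q s'"
  proof (cases "bval b s")
    case True
    then obtain s' where "reach t c1 s s'" "Q s'" using P assms(1) unfolding hoare_def by blast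
    then show ?thesis using reach_Cond[of t b s c1 Skip s'] True by auto
  next
    case False
    then show ?thesis using reach_Cond[of t b s c1 Skip s] P assms(2) by (auto simp: reach_Skip)
  qed
qed

text \<open>The variant \<open>m\<close> bounds the iterations that remain; each costs the body and
  two further steps, and the final step is the failing test.\<close>

lemma hoare_While:
  assumes "\<And>m. hoare (\<lambda>s. I m s \<and> bval b s) t c (\<lambda>s. \<exists>m'<m. I m' s)"
  shows "hoare (\<lambda>s. I m s) (m * (t + 2) + 1) (While b c) (\<lambda>s. (\<exists>m'\<le>m. I m' s) \<and> \<not> bval b s)"
  unfolding hoare_def
proof (intro allI impI)
  fix s assume "I m s"
  then show "\<exists>s'. reach (m * (t + 2) + 1) (While b c) s s' \<and> (\<exists>m'\<le>m. I m' s') \<and> \<not> bval b s'"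
  proof (induction m arbitrary: s rule: less_induct)
    case (less m)
    show ?case
    proof (cases "bval b s")
      case False
      then have "reach (m * (t + 2) + 1) (While b c) s s"
        using reach_mono[OF reach_While_False[OF False, of c], of "m * (t + 2) + 1"]
        by (simp only: le_add2)
      then show ?thesis using False less.prems by blast
    next
      case True
      then obtain s1 m1 where s1: "reach t c s s1" "m1 < m" "I m1 s1"
        using assms[of m] less.prems unfolding hoare_def by blast
      obtain s2 where s2: "reach (m1 * (t + 2) + 1) (While b c) s1 s2" "\<exists>m'\<le>m1. I m' s2" "\<not> bval b s2"
        using less.IH[OF s1(2,3)] by blast
      have "Suc m1 * (t + 2) \<le> m * (t + 2)" using s1(2) by (intro mult_right_mono) auto
      then have "reach (m * (t + 2) + 1) (While b c) s s2"
        by (intro reach_mono[OF reach_While_True[OF True s1(1) s2(1)]]) simp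
      then show ?thesis using s2 s1(2) by (meson le_trans less_imp_le)
    qed
  qed
qed

abbreviation (input) NV :: "nat \<Rightarrow> nexp" where
  "NV a \<equiv> NCell a (NConst 0) (NConst 0)"

abbreviation (input) nset :: "nat \<Rightarrow> nexp \<Rightarrow> com" where
  "nset a x \<equiv> NAssign a (NConst 0) (NConst 0) x"

definition For :: "nat \<Rightarrow> nexp \<Rightarrow> com \<Rightarrow> com" where
  "For a hi c = Seq (nset a (NConst 0)) (While (NLess (NV a) hi) (Seq c (nset a (NAdd (NV a) (NConst 1)))))"

definition set_counter :: "nat \<Rightarrow> nat \<Rightarrow> state \<Rightarrow> state" where
  "set_counter a x s = s\<lparr>nmem := (nmem s)((a, 0, 0) := x)\<rparr>"

text \<open>Per round, the four extra steps are two for the loop, one for the increment and one for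
  sequencing; the final three are the initialization, its sequencing and the failing test.\<close>

lemma hoare_For:
  assumes start: "\<And>s. P s \<Longrightarrow> I 0 (set_counter a 0 s)"
    and body: "\<And>i. i < N \<Longrightarrow> hoare (\<lambda>s. I i s \<and> nmem s (a, 0, 0) = i) t c
                 (\<lambda>s. nmem s (a, 0, 0) = i \<and> I (Suc i) (set_counter a (Suc i) s))"
    and hi: "\<And>i s. I i s \<Longrightarrow> nval hi s = N"
  shows "hoare P (N * (t + 4) + 3) (For a hi c) (I N)"
proof -
  \<comment> \<open>\<open>m\<close> counts the rounds that remain, so the counter holds
    \<open>N - m\<close>.\<close>
  define J where "J = (\<lambda>m s. m \<le> N \<and> I (N - m) s \<and> nmem s (a, 0, 0) = N - m)"
  have "hoare (\<lambda>s. J m s \<and> bval (NLess (NV a) hi) s) (t + 1 + 1)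
          (Seq c (nset a (NAdd (NV a) (NConst 1)))) (\<lambda>s. \<exists>m'<m. J m' s)" for m
  proof (cases "0 < m \<and> m \<le> N")
    case False
    then show ?thesis using hi unfolding hoare_def J_def by fastforce
  next
    case True
    then have lt: "N - m < N" and S: "Suc (N - m) = N - (m - 1)" by auto
    show ?thesis
    proof (rule hoare_Seq)
      show "hoare (\<lambda>s. J m s \<and> bval (NLess (NV a) hi) s) t c
          (\<lambda>s. nmem s (a, 0, 0) = N - m \<and> I (N - (m - 1)) (set_counter a (N - (m - 1)) s))"
        by (rule hoare_conseq[OF body[OF lt]]) (auto simp: J_def S)
    next
      show "hoare (\<lambda>s. nmem s (a, 0, 0) = N - m \<and> I (N - (m - 1)) (set_counter a (N - (m - 1)) s)) 1
           (nset a (NAdd (NV a) (NConst 1))) (\<lambda>s. \<exists>m'<m. J m' s)"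
      proof (rule hoare_NAssign, rule exI[of _ "m - 1"], goal_cases)
        case (1 s)
        have "nwrite a (NConst 0) (NConst 0) (nval (NAdd (NV a) (NConst 1)) s) s = set_counter a (N - (m - 1)) s"
          using 1 S by (simp add: nwrite_def set_counter_def)
        then show ?case using 1 True by (auto simp: J_def) (simp add: set_counter_def)
      qed
    qed
  qed
  note w = hoare_While[of J, OF this, of N]
  have i: "hoare P 1 (nset a (NConst 0)) (J N)"
    by (rule hoare_NAssign) (use start in \<open>auto simp: J_def nwrite_def set_counter_def\<close>)
  show ?thesis unfolding For_def
  proof (rule hoare_conseq[OF hoare_Seq[OF i w]], goal_cases)
    case (2 s)
    then obtain m where "m \<le> N" "I (N - m) s" "nmem s (a, 0, 0) = N - m" "\<not> N - m < nval hi s"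
      by (auto simp: J_def)
    then show ?case using hi[of "N - m" s] by (cases "m = 0") auto
  qed (auto simp: algebra_simps)
qed

lemma hoare_pointwise:
  assumes "\<And>s0. P s0 \<Longrightarrow> hoare (\<lambda>s. s = s0) t c Q"
  shows "hoare P t c Q"
  using assms unfolding hoare_def by blast

lemma hoareE:
  assumes "hoare P t c Q" and "P s"
  obtains s' where "reach t c s s'" and "Q s'"
  using assms unfolding hoare_def by blast

section \<open>Update and greedy selection\<close>

text \<open>Cell addresses such as \<open>(0, 1, 0)\<close> must not be rewritten to \<open>Suc 0\<close>.\<close>

declare One_nat_def [simp del]

text \<open>
  Scalars live at index \<open>(0, 0)\<close> of their array. Naturals: array 2 holds the row that is processed, 3, 4 and 10
  are loop counters, 5 is the best row found, 6 is \<open>B\<close>, 7 the total size of the design, and 8 and 9 the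
  multiplicities that an update adds and removes. Reals: array 1 holds the rows \<open>u\<close>, 2 the inverse \<open>G\<close>, 3 the
  vector \<open>G u\<close>, 4 and 5 the numbers \<open>u \<bullet> G u\<close> and \<open>|G u|\<^sup>2\<close>, and 6 the best score found.
\<close>

abbreviation (input) RV :: "nat \<Rightarrow> rexp" where
  "RV a \<equiv> RCell a (NConst 0) (NConst 0)"

abbreviation (input) rset :: "nat \<Rightarrow> rexp \<Rightarrow> com" where
  "rset a x \<equiv> RAssign a (NConst 0) (NConst 0) x"

abbreviation (input) dim_exp :: nexp where
  "dim_exp \<equiv> NCell 0 (NConst 1) (NConst 0)"

abbreviation (input) k_exp :: nexp where
  "k_exp \<equiv> NCell 0 (NConst 2) (NConst 0)"

text \<open>The coefficient \<open>c\<close> of the update. It is the difference of two naturals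
  taken over the reals, so that one program serves additions and removals.\<close>

abbreviation (input) sign_exp :: rexp where
  "sign_exp \<equiv> RSub (OfNat (NV 8)) (OfNat (NV 9))"

abbreviation (input) denom_exp :: rexp where
  "denom_exp \<equiv> RAdd (OfNat (NConst 1)) (RMul sign_exp (RV 4))"

text \<open>The change of the trace caused by the update, so that smaller is better in both greedy
  phases.\<close>

abbreviation (input) score_exp :: rexp where
  "score_exp \<equiv> RDiv (RSub (OfNat (NConst 0)) (RMul sign_exp (RV 5))) denom_exp"

section \<open>Programs for matrix-vector products, rank-one updates and greedy selection\<close>

definition mult_prog :: com where
  "mult_prog =
     Seq (rset 4 (OfNat (NConst 0)))
    (Seq (rset 5 (OfNat (NConst 0)))
    (For 3 dim_exp
      (Seq (RAssign 3 (NV 3) (NConst 0) (OfNat (NConst 0)))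
      (Seq (For 4 dim_exp
             (RAssign 3 (NV 3) (NConst 0)
               (RAdd (RCell 3 (NV 3) (NConst 0))
                 (RMul (RCell 2 (NV 3) (NV 4)) (RCell 1 (NV 2) (NV 4))))))
      (Seq (rset 4 (RAdd (RV 4) (RMul (RCell 1 (NV 2) (NV 3)) (RCell 3 (NV 3) (NConst 0)))))
           (rset 5 (RAdd (RV 5) (RMul (RCell 3 (NV 3) (NConst 0)) (RCell 3 (NV 3) (NConst 0))))))))))"

text \<open>The matrix is overwritten in place; this is sound because \<open>G u\<close> and
  \<open>u . G u\<close> have been stored beforehand.\<close>

definition update_prog :: com where
  "update_prog =
     Seq mult_prog
    (Seq (For 3 dim_exp (For 4 dim_exp
           (RAssign 2 (NV 3) (NV 4)
             (RSub (RCell 2 (NV 3) (NV 4))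
               (RDiv (RMul sign_exp (RMul (RCell 3 (NV 3) (NConst 0)) (RCell 3 (NV 4) (NConst 0))))
                     denom_exp)))))
    (Seq (NAssign 1 (NV 2) (NConst 0) (NSub (NAdd (NCell 1 (NV 2) (NConst 0)) (NV 8)) (NV 9)))
         (nset 7 (NSub (NAdd (NV 7) (NV 8)) (NV 9)))))"

text \<open>The index \<open>n\<close> in array 5 means that no row has been found yet. The test
  asks for a row in use with positive denominator, and for a strictly better score once a row has
  been found.\<close>

definition select_prog :: com where
  "select_prog =
     Seq (nset 5 (NV 0))
    (For 10 (NV 0)
      (Seq (nset 2 (NV 10))
      (Seq mult_prog
      (Cond (BAnd (NLess (NConst 0) (NCell 1 (NV 10) (NConst 0)))
            (BAnd (RLess (OfNat (NConst 0)) denom_exp)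
                  (BNot (BAnd (NLess (NV 5) (NV 0)) (BNot (RLess score_exp (RV 6)))))))
        (Seq (nset 5 (NV 10)) (rset 6 score_exp))
        Skip))))"

definition greedy_prog :: com where
  "greedy_prog = Seq select_prog (Seq (nset 2 (NV 5)) update_prog)"

section \<open>Frame conditions: which arrays a program may change\<close>

definition frame :: "nat set \<Rightarrow> nat set \<Rightarrow> state \<Rightarrow> state \<Rightarrow> bool" where
  "frame NS RS s s' \<longleftrightarrow>
     (\<forall>a i j. a \<notin> NS \<longrightarrow> nmem s' (a, i, j) = nmem s (a, i, j)) \<and>
     (\<forall>a i j. a \<notin> RS \<longrightarrow> rmem s' (a, i, j) = rmem s (a, i, j))"

definition mat_of :: "state \<Rightarrow> nat \<Rightarrow> nat \<Rightarrow> real" where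
  "mat_of s a b = rmem s (2, a, b)"

definition row_of :: "state \<Rightarrow> nat \<Rightarrow> nat \<Rightarrow> real" where
  "row_of s i b = rmem s (1, i, b)"

lemma frame_nmem: "frame NS RS s s' \<Longrightarrow> a \<notin> NS \<Longrightarrow> nmem s' (a, i, j) = nmem s (a, i, j)"
  unfolding frame_def by blast

lemma frame_rmem: "frame NS RS s s' \<Longrightarrow> a \<notin> RS \<Longrightarrow> rmem s' (a, i, j) = rmem s (a, i, j)"
  unfolding frame_def by blast

lemma frame_mat_of: "frame NS RS s s' \<Longrightarrow> 2 \<notin> RS \<Longrightarrow> mat_of s' = mat_of s"
  unfolding frame_def mat_of_def by auto

lemma frame_row_of: "frame NS RS s s' \<Longrightarrow> 1 \<notin> RS \<Longrightarrow> row_of s' = row_of s"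
  unfolding frame_def row_of_def by auto

lemma frame_read_design: "frame NS RS s s' \<Longrightarrow> 1 \<notin> NS \<Longrightarrow> read_design s' = read_design s"
  unfolding frame_def read_design_def by auto

lemma frame_trans:
  "frame NS RS s s' \<Longrightarrow> frame NS' RS' s' s'' \<Longrightarrow> NS \<subseteq> NS2 \<Longrightarrow> NS' \<subseteq> NS2 \<Longrightarrow> RS \<subseteq> RS2 \<Longrightarrow> RS' \<subseteq> RS2 \<Longrightarrow>
   frame NS2 RS2 s s''"
  unfolding frame_def by (metis subsetD)

lemma frame_mono: "frame NS RS s s' \<Longrightarrow> NS \<subseteq> NS' \<Longrightarrow> RS \<subseteq> RS' \<Longrightarrow> frame NS' RS' s s'"
  unfolding frame_def by (metis subsetD)

lemma frame_refl: "frame NS RS s s"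
  unfolding frame_def by simp

lemma frame_nwrite: "frame NS RS s s' \<Longrightarrow> a \<in> NS \<Longrightarrow> frame NS RS s (nwrite a i j x s')"
  unfolding frame_def nwrite_def by auto

lemma frame_rwrite: "frame NS RS s s' \<Longrightarrow> a \<in> RS \<Longrightarrow> frame NS RS s (rwrite a i j x s')"
  unfolding frame_def rwrite_def by auto

lemma frame_set_counter: "frame NS RS s s' \<Longrightarrow> a \<in> NS \<Longrightarrow> frame NS RS s (set_counter a x s')"
  unfolding frame_def set_counter_def by auto

lemma mem_nwrite [simp]:
  "nmem (nwrite a i j x s) = (nmem s)((a, nval i s, nval j s) := x)" "rmem (nwrite a i j x s) = rmem s"
  unfolding nwrite_def by auto

lemma mem_rwrite [simp]:
  "rmem (rwrite a i j x s) = (rmem s)((a, nval i s, nval j s) := x)" "nmem (rwrite a i j x s) = nmem s"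
  unfolding rwrite_def by auto

lemma mem_set_counter [simp]:
  "nmem (set_counter a x s) = (nmem s)((a, 0, 0) := x)" "rmem (set_counter a x s) = rmem s"
  unfolding set_counter_def by auto

section \<open>Correctness and running time of the update program\<close>

definition mult_time :: "nat \<Rightarrow> nat" where
  "mult_time d = d * (5 * d + 13) + 7"

lemma mult_prog_correct:
  assumes d: "d = nmem s0 (0, 1, 0)" and u: "u = row_of s0 (nmem s0 (2, 0, 0))"
  shows "hoare (\<lambda>s. s = s0) (mult_time d) mult_prog
    (\<lambda>s. frame {3, 4} {3, 4, 5} s0 s \<and> (\<forall>a<d. rmem s (3, a, 0) = mv d (mat_of s0) u a) \<and>
         rmem s (4, 0, 0) = lev d (mat_of s0) u \<and> rmem s (5, 0, 0) = sqn d (mat_of s0) u)"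
proof -
  define g where "g = mv d (mat_of s0) u"
  define F where "F = frame {3, 4} {3, 4, 5} s0"
  have Fn: "nmem s (a, i, j) = nmem s0 (a, i, j)" if "F s" "a \<noteq> 3" "a \<noteq> 4" for s a i j
    using frame_nmem[OF that(1)[unfolded F_def]] that by auto
  have Fr: "rmem s (1, i, j) = row_of s0 i j" "rmem s (2, i, j) = mat_of s0 i j" if "F s" for s i j
    using frame_rmem[OF that[unfolded F_def]] by (auto simp: row_of_def mat_of_def)
  have Fw: "F (rwrite a i j x s)" if "F s" "a \<in> {3, 4, 5}" for a i j x s
    using that unfolding F_def by (rule frame_rwrite)
  have Fc: "F (set_counter a x s)" if "F s" "a \<in> {3, 4}" for a x s
    using that unfolding F_def by (rule frame_set_counter)
  define I where "I = (\<lambda>a s. F s \<and> (\<forall>x<a. rmem s (3, x, 0) = g x) \<and>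
      rmem s (4, 0, 0) = (\<Sum>x<a. u x * g x) \<and> rmem s (5, 0, 0) = (\<Sum>x<a. g x * g x))"
  define J where "J = (\<lambda>a b s. I a s \<and> nmem s (3, 0, 0) = a \<and>
      rmem s (3, a, 0) = (\<Sum>x<b. mat_of s0 a x * u x))"
  have inner: "hoare (J a 0) (d * (1 + 4) + 3)
     (For 4 dim_exp
             (RAssign 3 (NV 3) (NConst 0)
               (RAdd (RCell 3 (NV 3) (NConst 0))
                 (RMul (RCell 2 (NV 3) (NV 4)) (RCell 1 (NV 2) (NV 4)))))) (J a d)" for a
  proof (rule hoare_For)
    fix s assume "J a 0 s" then show "J a 0 (set_counter 4 0 s)" by (auto simp: J_def I_def Fc)
  next
    fix i s assume "J a i s" then show "nval dim_exp s = d" by (auto simp: J_def I_def Fn d)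
  next
    fix i assume "i < d"
    show "hoare (\<lambda>s. J a i s \<and> nmem s (4, 0, 0) = i) 1
          (RAssign 3 (NV 3) (NConst 0)
            (RAdd (RCell 3 (NV 3) (NConst 0)) (RMul (RCell 2 (NV 3) (NV 4)) (RCell 1 (NV 2) (NV 4)))))
          (\<lambda>s. nmem s (4, 0, 0) = i \<and> J a (Suc i) (set_counter 4 (Suc i) s))"
      by (rule hoare_RAssign) (auto simp: J_def I_def Fc Fw Fr Fn u)
  qed
  have g: "g a = (\<Sum>x<d. mat_of s0 a x * u x)" for a unfolding g_def mv_def ..
  have body: "hoare (\<lambda>s. I a s \<and> nmem s (3, 0, 0) = a) (1 + ((d * (1 + 4) + 3) + (1 + 1 + 1) + 1) + 1)
      (Seq (RAssign 3 (NV 3) (NConst 0) (OfNat (NConst 0)))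
      (Seq (For 4 dim_exp
             (RAssign 3 (NV 3) (NConst 0)
               (RAdd (RCell 3 (NV 3) (NConst 0))
                 (RMul (RCell 2 (NV 3) (NV 4)) (RCell 1 (NV 2) (NV 4))))))
      (Seq (rset 4 (RAdd (RV 4) (RMul (RCell 1 (NV 2) (NV 3)) (RCell 3 (NV 3) (NConst 0)))))
           (rset 5 (RAdd (RV 5) (RMul (RCell 3 (NV 3) (NConst 0)) (RCell 3 (NV 3) (NConst 0))))))))
      (\<lambda>s. nmem s (3, 0, 0) = a \<and> I (Suc a) (set_counter 3 (Suc a) s))" for a
    apply (rule hoare_Seq[where Q = "J a 0"])
     apply (rule hoare_RAssign)
     apply (auto simp: J_def I_def Fw)[1]
    apply (rule hoare_Seq[OF inner])
    \<comment> \<open>Between the two accumulations, array 4 already includes the term of index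
      \<open>a\<close> while array 5 does not.\<close>
    apply (rule hoare_Seq[where Q = "\<lambda>s. F s \<and> nmem s (3, 0, 0) = a \<and> (\<forall>x<Suc a. rmem s (3, x, 0) = g x) \<and>
      rmem s (4, 0, 0) = (\<Sum>x<Suc a. u x * g x) \<and> rmem s (5, 0, 0) = (\<Sum>x<a. g x * g x)"])
     apply (rule hoare_RAssign)
     apply (auto simp: J_def I_def Fw Fr Fn u[symmetric] g less_Suc_eq)[1]
    apply (rule hoare_RAssign)
    apply (auto simp: I_def Fw Fc)
    done
  have outer: "hoare (I 0) (d * ((1 + ((d * (1 + 4) + 3) + (1 + 1 + 1) + 1) + 1) + 4) + 3)
     (For 3 dim_exp
      (Seq (RAssign 3 (NV 3) (NConst 0) (OfNat (NConst 0)))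
      (Seq (For 4 dim_exp
             (RAssign 3 (NV 3) (NConst 0)
               (RAdd (RCell 3 (NV 3) (NConst 0))
                 (RMul (RCell 2 (NV 3) (NV 4)) (RCell 1 (NV 2) (NV 4))))))
      (Seq (rset 4 (RAdd (RV 4) (RMul (RCell 1 (NV 2) (NV 3)) (RCell 3 (NV 3) (NConst 0)))))
           (rset 5 (RAdd (RV 5) (RMul (RCell 3 (NV 3) (NConst 0)) (RCell 3 (NV 3) (NConst 0)))))))))
     (I d)"
  proof (rule hoare_For[OF _ body])
    fix s assume "I 0 s" then show "I 0 (set_counter 3 0 s)" by (auto simp: I_def Fc)
  next
    fix i s assume "I i s" then show "nval dim_exp s = d" by (auto simp: I_def Fn d)
  qed
  have F0: "F s0" unfolding F_def by (rule frame_refl)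
  have a1: "hoare (\<lambda>s. s = s0) 1 (rset 4 (OfNat (NConst 0))) (\<lambda>s. F s \<and> rmem s (4, 0, 0) = 0)"
    by (rule hoare_RAssign) (auto simp: Fw F0)
  have a2: "hoare (\<lambda>s. F s \<and> rmem s (4, 0, 0) = 0) 1 (rset 5 (OfNat (NConst 0))) (I 0)"
    by (rule hoare_RAssign) (auto simp: Fw I_def)
  show ?thesis
    unfolding mult_prog_def
    by (rule hoare_conseq[OF hoare_Seq[OF a1 hoare_Seq[OF a2 outer]]])
      (auto simp: I_def F_def g_def inner_d_def mult_time_def algebra_simps)
qed

definition sign_of :: "state \<Rightarrow> real" where
  "sign_of s = real (nmem s (8, 0, 0)) - real (nmem s (9, 0, 0))"

definition update_time :: "nat \<Rightarrow> nat" where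
  "update_time d = mult_time d + d * (5 * d + 7) + 8"

lemma update_prog_correct:
  assumes d: "d = nmem s0 (0, 1, 0)" and j: "j = nmem s0 (2, 0, 0)"
  shows "hoare (\<lambda>s. s = s0) (update_time d) update_prog
    (\<lambda>s. frame {1, 3, 4, 7} {2, 3, 4, 5} s0 s \<and>
         (\<forall>a<d. \<forall>b<d. mat_of s a b = rank1_update d (mat_of s0) (row_of s0 j) (sign_of s0) a b) \<and>
         read_design s = (read_design s0)(j := read_design s0 j + nmem s0 (8, 0, 0) - nmem s0 (9, 0, 0)) \<and>
         nmem s (7, 0, 0) = nmem s0 (7, 0, 0) + nmem s0 (8, 0, 0) - nmem s0 (9, 0, 0))"
proof -
  define u where "u = row_of s0 j"
  define g where "g = mv d (mat_of s0) u"
  define R where "R = rank1_update d (mat_of s0) u (sign_of s0)"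
  define F where "F = frame {3, 4} {2, 3, 4, 5} s0"
  have Fn: "nmem s (a, i, j) = nmem s0 (a, i, j)" if "F s" "a \<noteq> 3" "a \<noteq> 4" for s a i j
    using frame_nmem[OF that(1)[unfolded F_def]] that by auto
  have Fw: "F (rwrite a i j x s)" if "F s" "a \<in> {2, 3, 4, 5}" for a i j x s
    using that unfolding F_def by (rule frame_rwrite)
  have Fc: "F (set_counter a x s)" if "F s" "a \<in> {3, 4}" for a x s
    using that unfolding F_def by (rule frame_set_counter)
  define V where "V = (\<lambda>s. F s \<and> (\<forall>a<d. rmem s (3, a, 0) = g a) \<and> rmem s (4, 0, 0) = lev d (mat_of s0) u)"
  define I where "I = (\<lambda>i s. V s \<and> (\<forall>a<d. \<forall>b<d. rmem s (2, a, b) = (if a < i then R a b else mat_of s0 a b)))"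
  \<comment> \<open>The matrix is processed row by row: entries before \<open>(i, l)\<close> have
    their new value, the others still the old one.\<close>
  define J where "J = (\<lambda>i l s. V s \<and> nmem s (3, 0, 0) = i \<and>
      (\<forall>a<d. \<forall>b<d. rmem s (2, a, b) = (if a < i \<or> a = i \<and> b < l then R a b else mat_of s0 a b)))"
  let ?as = "RAssign 2 (NV 3) (NV 4)
             (RSub (RCell 2 (NV 3) (NV 4))
               (RDiv (RMul sign_exp (RMul (RCell 3 (NV 3) (NConst 0)) (RCell 3 (NV 4) (NConst 0))))
                     denom_exp))"
  have inner: "hoare (J i 0) (d * (1 + 4) + 3) (For 4 dim_exp ?as) (J i d)" if i: "i < d" for i
  proof (rule hoare_For)
    fix s assume "J i 0 s" then show "J i 0 (set_counter 4 0 s)" by (auto simp: J_def V_def Fc)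
  next
    fix l s assume "J i l s" then show "nval dim_exp s = d" by (auto simp: J_def V_def Fn d)
  next
    fix l assume l: "l < d"
    show "hoare (\<lambda>s. J i l s \<and> nmem s (4, 0, 0) = l) 1 ?as
          (\<lambda>s. nmem s (4, 0, 0) = l \<and> J i (Suc l) (set_counter 4 (Suc l) s))"
    proof (rule hoare_RAssign, goal_cases)
      case (1 s)
      have J: "J i l s" and c: "nmem s (4, 0, 0) = l" "nmem s (3, 0, 0) = i" using 1 by (auto simp: J_def)
      have F: "F s" using J by (auto simp: J_def V_def)
      let ?s = "rwrite 2 (NV 3) (NV 4) (rval (RSub (RCell 2 (NV 3) (NV 4))
               (RDiv (RMul sign_exp (RMul (RCell 3 (NV 3) (NConst 0)) (RCell 3 (NV 4) (NConst 0))))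
                     denom_exp)) s) s"
      have val: "rmem ?s (2, i, l) = R i l"
        using J i l c by (simp add: J_def V_def Fn[OF F] R_def rank1_update_def g_def sign_of_def)
      have oth: "rmem ?s (a, x, y) = rmem s (a, x, y)" if "(a, x, y) \<noteq> (2, i, l)" for a x y
        using that c by auto
      have "V ?s" using J oth by (auto simp: J_def V_def Fw)
      then have "V (set_counter 4 (Suc l) ?s)" by (auto simp: V_def Fc)
      moreover have "rmem ?s (2, a, b) = (if a < i \<or> a = i \<and> b < Suc l then R a b else mat_of s0 a b)"
        if "a < d" "b < d" for a b
      proof (cases "a = i \<and> b = l")
        case True
        then show ?thesis using val by simp
      next
        case False
        then have "rmem ?s (2, a, b) = rmem s (2, a, b)" by (intro oth) auto
        then show ?thesis using False J that unfolding J_def by auto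
      qed
      ultimately show ?case unfolding J_def using c by simp
    qed
  qed
  have outer: "hoare (I 0) (d * ((d * (1 + 4) + 3) + 4) + 3) (For 3 dim_exp (For 4 dim_exp ?as)) (I d)"
  proof (rule hoare_For)
    fix s assume "I 0 s" then show "I 0 (set_counter 3 0 s)" by (auto simp: I_def V_def Fc)
  next
    fix l s assume "I l s" then show "nval dim_exp s = d" by (auto simp: I_def V_def Fn d)
  next
    fix i assume i: "i < d"
    show "hoare (\<lambda>s. I i s \<and> nmem s (3, 0, 0) = i) (d * (1 + 4) + 3) (For 4 dim_exp ?as)
          (\<lambda>s. nmem s (3, 0, 0) = i \<and> I (Suc i) (set_counter 3 (Suc i) s))"
      by (rule hoare_conseq[OF inner[OF i]]) (auto simp: I_def J_def V_def Fc less_Suc_eq)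
  qed
  have m: "hoare (\<lambda>s. s = s0) (mult_time d) mult_prog (I 0)"
  proof (rule hoare_conseq[OF mult_prog_correct[OF d refl]], goal_cases)
    case (2 s)
    then have "frame {3, 4} {3, 4, 5} s0 s" by blast
    then have "mat_of s = mat_of s0" by (rule frame_mat_of) auto
    then have "rmem s (2, a, b) = mat_of s0 a b" for a b by (metis mat_of_def)
    moreover have "F s" unfolding F_def using \<open>frame _ _ s0 s\<close> by (rule frame_mono) auto
    ultimately show ?case using 2 unfolding I_def V_def by (auto simp: g_def u_def j)
  qed auto
  let ?Y = "(read_design s0)(j := read_design s0 j + nmem s0 (8, 0, 0) - nmem s0 (9, 0, 0))"
  define K where "K = (\<lambda>NS s. frame NS {2, 3, 4, 5} s0 s \<and> (\<forall>a<d. \<forall>b<d. mat_of s a b = R a b) \<and> read_design s = ?Y)"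
  have y: "hoare (I d) 1 (NAssign 1 (NV 2) (NConst 0) (NSub (NAdd (NCell 1 (NV 2) (NConst 0)) (NV 8)) (NV 9)))
      (K {1, 3, 4})"
  proof (rule hoare_NAssign, goal_cases)
    case (1 s)
    then have F: "F s" by (auto simp: I_def V_def)
    have "frame {1, 3, 4} {2, 3, 4, 5} s0 s"
      using F unfolding F_def by (rule frame_mono) auto
    then show ?case using 1 unfolding K_def I_def V_def
      by (auto simp: Fn mat_of_def read_design_def j fun_eq_iff intro!: frame_nwrite)
  qed
  have c: "hoare (K {1, 3, 4}) 1 (nset 7 (NSub (NAdd (NV 7) (NV 8)) (NV 9)))
      (\<lambda>s. K {1, 3, 4, 7} s \<and> nmem s (7, 0, 0) = nmem s0 (7, 0, 0) + nmem s0 (8, 0, 0) - nmem s0 (9, 0, 0))"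
  proof (rule hoare_NAssign, goal_cases)
    case (1 s)
    then have F: "frame {1, 3, 4} {2, 3, 4, 5} s0 s" by (auto simp: K_def)
    have "frame {1, 3, 4, 7} {2, 3, 4, 5} s0 s"
      using F by (rule frame_mono) auto
    then show ?case using 1 unfolding K_def
      by (auto simp: frame_nmem[OF F] mat_of_def read_design_def fun_eq_iff intro!: frame_nwrite)
  qed
  show ?thesis
    unfolding update_prog_def
    by (rule hoare_conseq[OF hoare_Seq[OF m hoare_Seq[OF outer hoare_Seq[OF y c]]]])
      (auto simp: K_def R_def u_def update_time_def algebra_simps)
qed

section \<open>Correctness of the greedy selection\<close>

definition admissible :: "state \<Rightarrow> nat \<Rightarrow> bool" where
  "admissible s i \<longleftrightarrow> 0 < read_design s i \<and>
     0 < 1 + sign_of s * lev (nmem s (0, 1, 0)) (mat_of s) (row_of s i)"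

text \<open>By \<open>tr_rank1_update\<close> this is the change of the trace if the update is
  applied to row \<open>i\<close>.\<close>

definition score :: "state \<Rightarrow> nat \<Rightarrow> real" where
  "score s i = - (sign_of s * sqn (nmem s (0, 1, 0)) (mat_of s) (row_of s i)) /
     (1 + sign_of s * lev (nmem s (0, 1, 0)) (mat_of s) (row_of s i))"

definition select_time :: "nat \<Rightarrow> nat \<Rightarrow> nat" where
  "select_time n d = n * (mult_time d + 11) + 5"

lemma select_prog_correct:
  assumes n: "n = nmem s0 (0, 0, 0)" and d: "d = nmem s0 (0, 1, 0)"
    and ex: "\<exists>i<n. admissible s0 i"
  shows "hoare (\<lambda>s. s = s0) (select_time n d) select_prog
    (\<lambda>s. frame {2, 3, 4, 5, 10} {3, 4, 5, 6} s0 s \<and>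
         (\<exists>j<n. nmem s (5, 0, 0) = j \<and> admissible s0 j \<and> (\<forall>i<n. admissible s0 i \<longrightarrow> score s0 j \<le> score s0 i)))"
proof -
  define F where "F = frame {2, 3, 4, 5, 10} {3, 4, 5, 6} s0"
  have Fn: "nmem s (a, i, j) = nmem s0 (a, i, j)" if "F s" "a \<notin> {2, 3, 4, 5, 10}" for s a i j
    using frame_nmem[OF that(1)[unfolded F_def]] that by auto
  have Fw: "F (rwrite a i j x s)" if "F s" "a \<in> {3, 4, 5, 6}" for a i j x s
    using that unfolding F_def by (rule frame_rwrite)
  have Fnw: "F (nwrite a i j x s)" if "F s" "a \<in> {2, 3, 4, 5, 10}" for a i j x s
    using that unfolding F_def by (rule frame_nwrite)
  have Fc: "F (set_counter a x s)" if "F s" "a \<in> {2, 3, 4, 5, 10}" for a x s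
    using that unfolding F_def by (rule frame_set_counter)
  \<comment> \<open>In the first alternative \<open>b = n\<close> marks that there is no candidate
    yet, and \<open>r\<close> is arbitrary.\<close>
  define Best where "Best = (\<lambda>i b r. (b = n \<and> (\<forall>x<i. \<not> admissible s0 x)) \<or>
     (b < i \<and> b < n \<and> admissible s0 b \<and> r = score s0 b \<and> (\<forall>x<i. admissible s0 x \<longrightarrow> score s0 b \<le> score s0 x)))"
  have Best_Suc: "Best (Suc i) (if t then i else b) (if t then score s0 i else r)"
    if "Best i b r" "i < n" "t \<longleftrightarrow> admissible s0 i \<and> \<not> (b < n \<and> \<not> score s0 i < r)" for i b r t
    using that unfolding Best_def by (auto simp: less_Suc_eq)
  define I where "I = (\<lambda>i s. F s \<and> Best i (nmem s (5, 0, 0)) (rmem s (6, 0, 0)))"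
  let ?test = "BAnd (NLess (NConst 0) (NCell 1 (NV 10) (NConst 0)))
            (BAnd (RLess (OfNat (NConst 0)) denom_exp)
                  (BNot (BAnd (NLess (NV 5) (NV 0)) (BNot (RLess score_exp (RV 6))))))"
  let ?body = "Seq (nset 2 (NV 10)) (Seq mult_prog (Cond ?test
        (Seq (nset 5 (NV 10)) (rset 6 score_exp)) Skip))"
  have body: "hoare (\<lambda>s. I i s \<and> nmem s (10, 0, 0) = i) (1 + (mult_time d + ((1 + 1 + 1) + 1) + 1) + 1) ?body
      (\<lambda>s. nmem s (10, 0, 0) = i \<and> I (Suc i) (set_counter 10 (Suc i) s))" if i: "i < n" for i
  proof -
    define K where "K = (\<lambda>s. I i s \<and> nmem s (10, 0, 0) = i \<and> nmem s (2, 0, 0) = i)"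
    define L where "L = (\<lambda>s. I i s \<and> nmem s (10, 0, 0) = i \<and>
       rmem s (4, 0, 0) = lev d (mat_of s0) (row_of s0 i) \<and> rmem s (5, 0, 0) = sqn d (mat_of s0) (row_of s0 i))"
    have 1: "hoare (\<lambda>s. I i s \<and> nmem s (10, 0, 0) = i) 1 (nset 2 (NV 10)) K"
      by (rule hoare_NAssign) (auto simp: I_def K_def Fnw)
    have 2: "hoare K (mult_time d) mult_prog L"
      unfolding hoare_def
    proof (intro allI impI)
      fix s assume K: "K s"
      then have F: "F s" by (auto simp: K_def I_def)
      have same: "mat_of s = mat_of s0" "row_of s = row_of s0"
        using F unfolding F_def by (auto intro!: frame_mat_of frame_row_of)
      have dd: "d = nmem s (0, 1, 0)" using Fn[OF F] d by simp
      obtain s' where s': "reach (mult_time d) mult_prog s s'" "frame {3, 4} {3, 4, 5} s s'"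
          "rmem s' (4, 0, 0) = lev d (mat_of s) (row_of s (nmem s (2, 0, 0)))"
          "rmem s' (5, 0, 0) = sqn d (mat_of s) (row_of s (nmem s (2, 0, 0)))"
        using mult_prog_correct[OF dd refl] unfolding hoare_def by blast
      have "F s'" unfolding F_def by (rule frame_trans[OF F[unfolded F_def] s'(2)]) auto
      then have "L s'" using K s'(3,4) frame_nmem[OF s'(2)] frame_rmem[OF s'(2)]
        by (auto simp: L_def K_def I_def same)
      then show "\<exists>s'. reach (mult_time d) mult_prog s s' \<and> L s'" using s'(1) by blast
    qed
    have vals: "rval score_exp s = score s0 i" "bval ?test s \<longleftrightarrow> admissible s0 i \<and>
       \<not> (nmem s (5, 0, 0) < n \<and> \<not> score s0 i < rmem s (6, 0, 0))" if "L s" for s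
    proof -
      have F: "F s" using that by (auto simp: L_def I_def)
      have sg: "real (nmem s (8, 0, 0)) - real (nmem s (9, 0, 0)) = sign_of s0"
        by (simp add: Fn[OF F] sign_of_def)
      show sc: "rval score_exp s = score s0 i"
        using that by (simp add: sg L_def score_def d)
      show "bval ?test s \<longleftrightarrow> admissible s0 i \<and>
         \<not> (nmem s (5, 0, 0) < n \<and> \<not> score s0 i < rmem s (6, 0, 0))"
        using that sc by (simp add: L_def admissible_def Fn[OF F] n d read_design_def sign_of_def)
    qed
    have 3: "hoare L ((1 + 1 + 1) + 1) (Cond ?test (Seq (nset 5 (NV 10)) (rset 6 score_exp)) Skip)
       (\<lambda>s. nmem s (10, 0, 0) = i \<and> I (Suc i) (set_counter 10 (Suc i) s))"
    proof (rule hoare_Cond)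
      fix s assume L: "L s" and nb: "\<not> bval ?test s"
      have "Best (Suc i) (nmem s (5, 0, 0)) (rmem s (6, 0, 0))"
        using Best_Suc[of i "nmem s (5, 0, 0)" "rmem s (6, 0, 0)" False] nb[unfolded vals(2)[OF L]] L i
        by (auto simp: L_def I_def)
      then show "nmem s (10, 0, 0) = i \<and> I (Suc i) (set_counter 10 (Suc i) s)"
        using L by (auto simp: L_def I_def Fc)
    next
      have a: "hoare (\<lambda>s. L s \<and> bval ?test s) 1 (nset 5 (NV 10))
          (\<lambda>s. F s \<and> nmem s (10, 0, 0) = i \<and> Best (Suc i) (nmem s (5, 0, 0)) (score s0 i) \<and> rval score_exp s = score s0 i)"
      proof (rule hoare_NAssign, goal_cases)
        case (1 s)
        have "Best (Suc i) i (score s0 i)"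
          using Best_Suc[of i "nmem s (5, 0, 0)" "rmem s (6, 0, 0)" True]
            1[THEN conjunct2, unfolded vals(2)[OF 1[THEN conjunct1]]] 1[THEN conjunct1] i
          by (auto simp: L_def I_def)
        \<comment> \<open>\<open>score_exp\<close> does not read array 5 of the naturals, so its
          value survives the assignment of the index.\<close>
        moreover have "rval score_exp (nwrite 5 (NConst 0) (NConst 0) (nval (NV 10) s) s) = rval score_exp s"
          by simp
        ultimately show ?case using 1 vals(1)[of s] by (simp add: L_def I_def Fnw del: rval.simps)
      qed
      have b: "hoare (\<lambda>s. F s \<and> nmem s (10, 0, 0) = i \<and> Best (Suc i) (nmem s (5, 0, 0)) (score s0 i) \<and> rval score_exp s = score s0 i)
          1 (rset 6 score_exp) (\<lambda>s. nmem s (10, 0, 0) = i \<and> I (Suc i) (set_counter 10 (Suc i) s))"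
        by (rule hoare_RAssign) (simp add: I_def Fw Fc del: rval.simps)
      show "hoare (\<lambda>s. L s \<and> bval ?test s) (1 + 1 + 1) (Seq (nset 5 (NV 10)) (rset 6 score_exp))
          (\<lambda>s. nmem s (10, 0, 0) = i \<and> I (Suc i) (set_counter 10 (Suc i) s))"
        by (rule hoare_Seq[OF a b])
    qed
    show ?thesis by (rule hoare_Seq[OF 1 hoare_Seq[OF 2 3]])
  qed
  have loop: "hoare (I 0) (n * ((1 + (mult_time d + ((1 + 1 + 1) + 1) + 1) + 1) + 4) + 3) (For 10 (NV 0) ?body) (I n)"
  proof (rule hoare_For[OF _ body])
    fix s assume "I 0 s" then show "I 0 (set_counter 10 0 s)" by (auto simp: I_def Fc)
  next
    fix i s assume "I i s" then show "nval (NV 0) s = n" by (auto simp: I_def Fn n)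
  qed
  have F0: "F s0" unfolding F_def by (rule frame_refl)
  have init: "hoare (\<lambda>s. s = s0) 1 (nset 5 (NV 0)) (I 0)"
    by (rule hoare_NAssign) (auto simp: I_def Fnw F0 Best_def n)
  show ?thesis
    unfolding select_prog_def
    apply (rule hoare_conseq[OF hoare_Seq[OF init loop]])
      apply simp
    using ex apply (auto simp: I_def F_def Best_def)[1]
    apply (simp add: select_time_def algebra_simps)
    done
qed

definition greedy_time :: "nat \<Rightarrow> nat \<Rightarrow> nat" where
  "greedy_time n d = select_time n d + update_time d + 3"

lemma greedy_prog_correct:
  assumes n: "n = nmem s0 (0, 0, 0)" and d: "d = nmem s0 (0, 1, 0)"
    and ex: "\<exists>i<n. admissible s0 i"
  shows "hoare (\<lambda>s. s = s0) (greedy_time n d) greedy_prog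
    (\<lambda>s. frame {1, 2, 3, 4, 5, 7, 10} {2, 3, 4, 5, 6} s0 s \<and>
         (\<exists>j<n. admissible s0 j \<and> (\<forall>i<n. admissible s0 i \<longrightarrow> score s0 j \<le> score s0 i) \<and>
         (\<forall>a<d. \<forall>b<d. mat_of s a b = rank1_update d (mat_of s0) (row_of s0 j) (sign_of s0) a b) \<and>
         read_design s = (read_design s0)(j := read_design s0 j + nmem s0 (8, 0, 0) - nmem s0 (9, 0, 0)) \<and>
         nmem s (7, 0, 0) = nmem s0 (7, 0, 0) + nmem s0 (8, 0, 0) - nmem s0 (9, 0, 0)))"
  unfolding hoare_def
proof (intro allI impI)
  fix s assume s: "s = s0"
  obtain s1 j where s1: "reach (select_time n d) select_prog s0 s1" "frame {2, 3, 4, 5, 10} {3, 4, 5, 6} s0 s1"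
     and j: "j < n" "nmem s1 (5, 0, 0) = j" "admissible s0 j" "\<forall>i<n. admissible s0 i \<longrightarrow> score s0 j \<le> score s0 i"
    using select_prog_correct[OF assms] unfolding hoare_def by blast
  define s2 where "s2 = nwrite 2 (NConst 0) (NConst 0) (nval (NV 5) s1) s1"
  have r2: "reach 1 (nset 2 (NV 5)) s1 s2" unfolding s2_def by (rule reach_NAssign)
  have f2: "frame {2, 3, 4, 5, 10} {3, 4, 5, 6} s0 s2"
    unfolding s2_def by (rule frame_nwrite[OF s1(2)]) simp
  have j2: "j = nmem s2 (2, 0, 0)" unfolding s2_def using j(2) by simp
  have d2: "d = nmem s2 (0, 1, 0)" using frame_nmem[OF f2] d by simp
  obtain s3 where s3: "reach (update_time d) update_prog s2 s3" "frame {1, 3, 4, 7} {2, 3, 4, 5} s2 s3"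
     "\<forall>a<d. \<forall>b<d. mat_of s3 a b = rank1_update d (mat_of s2) (row_of s2 j) (sign_of s2) a b"
     "read_design s3 = (read_design s2)(j := read_design s2 j + nmem s2 (8, 0, 0) - nmem s2 (9, 0, 0))"
     "nmem s3 (7, 0, 0) = nmem s2 (7, 0, 0) + nmem s2 (8, 0, 0) - nmem s2 (9, 0, 0)"
    using update_prog_correct[OF d2 j2] unfolding hoare_def by blast
  have same: "mat_of s2 = mat_of s0" "row_of s2 = row_of s0" "read_design s2 = read_design s0" "sign_of s2 = sign_of s0"
    using frame_mat_of[OF f2] frame_row_of[OF f2] frame_read_design[OF f2] frame_nmem[OF f2]
    by (auto simp: sign_of_def)
  have f3: "frame {1, 2, 3, 4, 5, 7, 10} {2, 3, 4, 5, 6} s0 s3" by (rule frame_trans[OF f2 s3(2)]) auto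
  have "reach (select_time n d + (1 + update_time d + 1) + 1) greedy_prog s0 s3"
    unfolding greedy_prog_def by (rule reach_Seq[OF s1(1) reach_Seq[OF r2 s3(1)]])
  then have "reach (greedy_time n d) greedy_prog s s3"
    unfolding s by (rule reach_mono) (simp add: greedy_time_def)
  then show "\<exists>s'. reach (greedy_time n d) greedy_prog s s' \<and>
        frame {1, 2, 3, 4, 5, 7, 10} {2, 3, 4, 5, 6} s0 s' \<and>
         (\<exists>j<n. admissible s0 j \<and> (\<forall>i<n. admissible s0 i \<longrightarrow> score s0 j \<le> score s0 i) \<and>
         (\<forall>a<d. \<forall>b<d. mat_of s' a b = rank1_update d (mat_of s0) (row_of s0 j) (sign_of s0) a b) \<and>
         read_design s' = (read_design s0)(j := read_design s0 j + nmem s0 (8, 0, 0) - nmem s0 (9, 0, 0)) \<and>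
         nmem s' (7, 0, 0) = nmem s0 (7, 0, 0) + nmem s0 (8, 0, 0) - nmem s0 (9, 0, 0))"
    using f3 j s3(3-5) same frame_nmem[OF f2] by (intro exI[of _ s3]) auto
qed

section \<open>The design algorithm\<close>

text \<open>Rows \<open>n, ..., n + d - 1\<close> become the unit vectors, each with multiplicity 1,
  and the matrix becomes the identity. \<open>B\<close> is found by counting upwards, as the machine
  model has no rounding of reals.\<close>

definition init_prog :: com where
  "init_prog =
     Seq (For 3 dim_exp
       (Seq (RAssign 1 (NAdd (NV 0) (NV 3)) (NV 3) (OfNat (NConst 1)))
       (Seq (RAssign 2 (NV 3) (NV 3) (OfNat (NConst 1)))
            (NAssign 1 (NAdd (NV 0) (NV 3)) (NConst 0) (NConst 1)))))
    (Seq (nset 7 dim_exp)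
    (Seq (nset 6 (NConst 1))
         (While (RLess (RMul (OfNat (NV 6)) (RV 0)) (RMul (OfNat (NConst 6)) (OfNat k_exp)))
            (nset 6 (NAdd (NV 6) (NConst 1))))))"

definition load_prog :: "nexp \<Rightarrow> nexp \<Rightarrow> nexp \<Rightarrow> nexp \<Rightarrow> com" where
  "load_prog up dn hi ix =
     Seq (nset 8 up) (Seq (nset 9 dn) (For 10 hi (Seq (nset 2 ix) update_prog)))"

definition greedy_loop :: "nexp \<Rightarrow> nexp \<Rightarrow> bexp \<Rightarrow> com" where
  "greedy_loop up dn b = Seq (nset 8 up) (Seq (nset 9 dn) (While b greedy_prog))"

text \<open>After the initialization the phases are: insert every vector \<open>B\<close> times,
  remove the unit vectors, grow to size \<open>n B (B + 1)\<close>, shrink to size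
  \<open>k\<close>.\<close>

definition design_prog :: com where
  "design_prog =
     Seq init_prog
    (Seq (load_prog (NV 6) (NConst 0) (NV 0) (NV 10))
    (Seq (load_prog (NConst 0) (NConst 1) dim_exp (NAdd (NV 0) (NV 10)))
    (Seq (greedy_loop (NConst 1) (NConst 0)
            (RLess (OfNat (NV 7)) (RMul (OfNat (NV 0)) (RMul (OfNat (NV 6)) (RAdd (OfNat (NV 6)) (OfNat (NConst 1)))))))
         (greedy_loop (NConst 0) (NConst 1) (NLess k_exp (NV 7))))))"

lemma sum_nat_update:
  fixes y :: "nat \<Rightarrow> nat"
  assumes "j < m" and "q \<le> y j + p"
  shows "(\<Sum>i<m. (y(j := y j + p - q)) i) = (\<Sum>i<m. y i) + p - q"
proof -
  have "(\<Sum>i<m. (y(j := y j + p - q)) i) = (y j + p - q) + (\<Sum>i\<in>{..<m} - {j}. y i)"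
    using assms(1) by (subst sum.remove[of _ j]) auto
  moreover have "(\<Sum>i<m. y i) = y j + (\<Sum>i\<in>{..<m} - {j}. y i)"
    using assms(1) by (intro sum.remove) auto
  ultimately show ?thesis using assms(2) by simp
qed

text \<open>Drops the unit rows from the information matrix once their multiplicities are
  zero.\<close>

lemma moment_restrict:
  assumes "n \<le> m" and "\<And>i. n \<le> i \<Longrightarrow> y i = 0"
  shows "moment m v y = moment n v y"
  unfolding moment_def fun_eq_iff
  by (intro allI sum.mono_neutral_right) (use assms in auto)

section \<open>Invariants of the algorithm on a fixed instance, and the first inverse\<close>

locale design_instance =
  fixes n d k :: nat and \<epsilon> :: real and v :: "nat \<Rightarrow> real vec"
  assumes d_pos: "0 < d" and dk: "d \<le> k" and eps: "0 < \<epsilon>" and span: "spanning_vectors n d v"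
begin

text \<open>The unit vectors are appended as rows \<open>n, \<dots>, n + d - 1\<close>: starting from the identity matrix and removing
  them after the vectors have been added computes the first inverse by rank-one updates alone.\<close>

definition ext_row :: "nat \<Rightarrow> nat \<Rightarrow> real" where
  "ext_row i b = (if i < n then (if b < d then vec_index (v i) b else 0) else if i < n + d \<and> i = n + b then 1 else 0)"

text \<open>The invariant shared by all phases after the initialization. It refers to all
  \<open>n + d\<close> rows, so it covers the unit rows while they belong to the design.\<close>

definition ready :: "nat \<Rightarrow> state \<Rightarrow> bool" where
  "ready B s \<longleftrightarrow>
     nmem s (0, 0, 0) = n \<and> nmem s (0, 1, 0) = d \<and> nmem s (0, 2, 0) = k \<and> nmem s (6, 0, 0) = B \<and>
     row_of s = ext_row \<and> sym_inverse d (moment (n + d) ext_row (read_design s)) (mat_of s) \<and>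
     nmem s (7, 0, 0) = (\<Sum>i<n + d. read_design s i)"

lemma n_pos: "0 < n"
proof (rule ccontr)
  interpret vec_space "TYPE(real)" d .
  assume "\<not> 0 < n"
  then have "span {} = carrier_vec d" using span unfolding spanning_vectors_def by simp
  then have "unit_vec d 0 \<in> {0\<^sub>v d :: real vec}" using span_empty by auto
  then have "vec_index (unit_vec d 0) 0 = (0 :: real)" using d_pos by simp
  then show False using d_pos by simp
qed

text \<open>A vector orthogonal to all \<open>v i\<close> is orthogonal to their span and hence to
  itself. This puts the spanning hypothesis into the form that \<open>unit_lev_less_1\<close> asks
  for.\<close>

lemma ext_row_separating:
  assumes "\<And>i. i < n \<Longrightarrow> inner_d d (ext_row i) w = 0" and a: "a < d"
  shows "w a = 0"
proof -
  interpret vec_space "TYPE(real)" d .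
  let ?w = "vec d w"
  have car: "v ` {..<n} \<subseteq> carrier_vec d" and sp: "span (v ` {..<n}) = carrier_vec d"
    using span unfolding spanning_vectors_def by auto
  have "?w \<bullet> v i = 0" if i: "i < n" for i
  proof -
    have "dim_vec (v i) = d" using car i by auto
    then have "?w \<bullet> v i = inner_d d (ext_row i) w"
      unfolding scalar_prod_def inner_d_def
      using i by (intro sum.cong) (auto simp: ext_row_def atLeast0LessThan mult.commute)
    then show ?thesis using assms(1)[OF i] by simp
  qed
  then have "?w \<in> orthogonal_complement (v ` {..<n})" unfolding orthogonal_complement_def by auto
  then have "?w \<in> orthogonal_complement (carrier_vec d)"
    using in_orthogonal_complement_span[OF car] sp by simp
  then have "?w \<bullet> ?w = 0" unfolding orthogonal_complement_def by auto
  then have "(\<Sum>i<d. w i * w i) = 0" by (simp add: scalar_prod_def atLeast0LessThan)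
  then have "\<forall>i\<in>{..<d}. w i * w i = 0" by (subst (asm) sum_nonneg_eq_0_iff) auto
  then show ?thesis using a by auto
qed

text \<open>The two sets consist of arrays that \<open>ready\<close> does not read.\<close>

lemma ready_frame:
  assumes "ready B s" and f: "frame {2, 3, 4, 5, 8, 9, 10} {3, 4, 5, 6} s s'"
  shows "ready B s'"
  using assms(1) frame_nmem[OF f] frame_mat_of[OF f] frame_row_of[OF f] frame_read_design[OF f]
  unfolding ready_def by simp

text \<open>The link between memory and linear algebra: \<open>moment_update\<close> describes the
  new design and \<open>sherman_morrison\<close> its inverse. The frame is wide enough for a greedy
  round as well as for a single update.\<close>

lemma ready_step:
  assumes r: "ready B s" and f: "frame {1, 2, 3, 4, 5, 7, 10} {2, 3, 4, 5, 6} s s'" and j: "j < n + d"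
    and mat: "\<forall>a<d. \<forall>b<d. mat_of s' a b = rank1_update d (mat_of s) (row_of s j) (sign_of s) a b"
    and y: "read_design s' = (read_design s)(j := read_design s j + nmem s (8, 0, 0) - nmem s (9, 0, 0))"
    and c: "nmem s' (7, 0, 0) = nmem s (7, 0, 0) + nmem s (8, 0, 0) - nmem s (9, 0, 0)"
    and le: "nmem s (9, 0, 0) \<le> read_design s j + nmem s (8, 0, 0)"
    and nz: "1 + sign_of s * lev d (mat_of s) (ext_row j) \<noteq> 0"
  shows "ready B s'" and "tr d (mat_of s') =
     tr d (mat_of s) - sign_of s * sqn d (mat_of s) (ext_row j) / (1 + sign_of s * lev d (mat_of s) (ext_row j))"
proof -
  have row: "row_of s = ext_row" and inv: "sym_inverse d (moment (n + d) ext_row (read_design s)) (mat_of s)"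
    using r by (auto simp: ready_def)
  have row': "row_of s' = row_of s" using frame_row_of[OF f] by simp
  have m: "moment (n + d) ext_row (read_design s') a b = moment (n + d) ext_row (read_design s) a b + sign_of s * (ext_row j a * ext_row j b)" for a b
    by (rule moment_update[OF j]) (use y le in \<open>auto simp: sign_of_def\<close>)
  have "sym_inverse d (moment (n + d) ext_row (read_design s')) (rank1_update d (mat_of s) (ext_row j) (sign_of s))"
    by (rule sherman_morrison[OF inv nz]) (rule m)
  then have "sym_inverse d (moment (n + d) ext_row (read_design s')) (mat_of s')"
    by (rule sym_inverse_cong) (use mat row in auto)
  moreover have "nmem s' (7, 0, 0) = (\<Sum>i<n + d. read_design s' i)"
    unfolding c y using sum_nat_update[of j "n + d" "nmem s (9, 0, 0)" "read_design s", OF j le] r by (simp add: ready_def)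
  ultimately show "ready B s'" using r frame_nmem[OF f] row' by (simp add: ready_def)
  have "tr d (mat_of s') = tr d (rank1_update d (mat_of s) (ext_row j) (sign_of s))"
    by (rule tr_cong) (use mat row in auto)
  then show "tr d (mat_of s') =
     tr d (mat_of s) - sign_of s * sqn d (mat_of s) (ext_row j) / (1 + sign_of s * lev d (mat_of s) (ext_row j))"
    by (simp add: tr_rank1_update)
qed

lemma ready_update:
  assumes r: "ready B s0" and j: "j = nval e s0" "j < n + d"
    and le: "nmem s0 (9, 0, 0) \<le> read_design s0 j + nmem s0 (8, 0, 0)"
    and pos: "0 < 1 + sign_of s0 * lev d (mat_of s0) (ext_row j)"
  shows "hoare (\<lambda>s. s = s0) (update_time d + 2) (Seq (nset 2 e) update_prog)
    (\<lambda>s. frame {1, 2, 3, 4, 7} {2, 3, 4, 5} s0 s \<and> ready B s \<and>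
         read_design s = (read_design s0)(j := read_design s0 j + nmem s0 (8, 0, 0) - nmem s0 (9, 0, 0)))"
  unfolding hoare_def
proof (intro allI impI)
  fix s assume s: "s = s0"
  define s1 where "s1 = nwrite 2 (NConst 0) (NConst 0) (nval e s0) s0"
  have r1: "reach 1 (nset 2 e) s0 s1" unfolding s1_def by (rule reach_NAssign)
  have f1: "frame {2} {} s0 s1" unfolding s1_def by (rule frame_nwrite[OF frame_refl]) simp
  have j1: "j = nmem s1 (2, 0, 0)" unfolding s1_def using j by simp
  have d1: "d = nmem s1 (0, 1, 0)" using frame_nmem[OF f1] r by (simp add: ready_def)
  have same: "mat_of s1 = mat_of s0" "row_of s1 = row_of s0" "read_design s1 = read_design s0" "sign_of s1 = sign_of s0"
    using frame_mat_of[OF f1] frame_row_of[OF f1] frame_read_design[OF f1] frame_nmem[OF f1]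
    by (auto simp: sign_of_def)
  obtain s2 where s2: "reach (update_time d) update_prog s1 s2" "frame {1, 3, 4, 7} {2, 3, 4, 5} s1 s2"
     "\<forall>a<d. \<forall>b<d. mat_of s2 a b = rank1_update d (mat_of s1) (row_of s1 j) (sign_of s1) a b"
     "read_design s2 = (read_design s1)(j := read_design s1 j + nmem s1 (8, 0, 0) - nmem s1 (9, 0, 0))"
     "nmem s2 (7, 0, 0) = nmem s1 (7, 0, 0) + nmem s1 (8, 0, 0) - nmem s1 (9, 0, 0)"
    using update_prog_correct[OF d1 j1] unfolding hoare_def by blast
  have f2: "frame {1, 2, 3, 4, 7} {2, 3, 4, 5} s0 s2" by (rule frame_trans[OF f1 s2(2)]) auto
  have f2': "frame {1, 2, 3, 4, 5, 7, 10} {2, 3, 4, 5, 6} s0 s2" using f2 by (rule frame_mono) auto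
  have y2: "read_design s2 = (read_design s0)(j := read_design s0 j + nmem s0 (8, 0, 0) - nmem s0 (9, 0, 0))"
    using s2(4) same frame_nmem[OF f1] by simp
  have "ready B s2"
    by (rule ready_step[OF r f2' j(2) _ y2 _ le])
      (use s2(3,5) same frame_nmem[OF f1] pos in auto)
  moreover have "reach (update_time d + 2) (Seq (nset 2 e) update_prog) s s2"
    unfolding s by (rule reach_mono[OF reach_Seq[OF r1 s2(1)]]) simp
  ultimately show "\<exists>s'. reach (update_time d + 2) (Seq (nset 2 e) update_prog) s s' \<and>
      frame {1, 2, 3, 4, 7} {2, 3, 4, 5} s0 s' \<and> ready B s' \<and>
         read_design s' = (read_design s0)(j := read_design s0 j + nmem s0 (8, 0, 0) - nmem s0 (9, 0, 0))"
    using f2 y2 by blast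
qed

text \<open>\<open>Y i\<close> is the design after \<open>i\<close> rounds. Positivity is asked for
  every inverse belonging to \<open>Y i\<close> because the matrix in memory is known only through
  \<open>ready\<close>.\<close>

lemma load_prog_correct:
  assumes start: "ready B s0"
    and exps: "\<And>s. ready B s \<Longrightarrow> nval up s = p" "\<And>s. ready B s \<Longrightarrow> nval dn s = q"
      "\<And>s. ready B s \<Longrightarrow> nval hi s = N"
      "\<And>s. ready B s \<Longrightarrow> nval ix s = r (nmem s (10, 0, 0))"
    and r: "\<And>i. i < N \<Longrightarrow> r i < n + d"
    and Y0: "Y 0 = read_design s0"
    and Y: "\<And>i. i < N \<Longrightarrow> Y (Suc i) = (Y i)(r i := Y i (r i) + p - q)" "\<And>i. i < N \<Longrightarrow> q \<le> Y i (r i) + p"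
    and pos: "\<And>i G. i < N \<Longrightarrow> sym_inverse d (moment (n + d) ext_row (Y i)) G \<Longrightarrow>
                0 < 1 + (real p - real q) * lev d G (ext_row (r i))"
  shows "\<exists>s. reach (N * (update_time d + 6) + 7) (load_prog up dn hi ix) s0 s \<and> ready B s \<and> read_design s = Y N"
proof -
  define I where "I = (\<lambda>i s. ready B s \<and> nmem s (8, 0, 0) = p \<and> nmem s (9, 0, 0) = q \<and> read_design s = Y i)"
  have wr: "ready B (nwrite a (NConst 0) (NConst 0) x s)" "read_design (nwrite a (NConst 0) (NConst 0) x s) = read_design s"
    if "ready B s" "a \<in> {8, 9}" for a x s
  proof -
    have f: "frame {2, 3, 4, 5, 8, 9, 10} {3, 4, 5, 6} s (nwrite a (NConst 0) (NConst 0) x s)"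
      by (rule frame_nwrite[OF frame_refl]) (use that in auto)
    show "ready B (nwrite a (NConst 0) (NConst 0) x s)" by (rule ready_frame[OF that(1) f])
    show "read_design (nwrite a (NConst 0) (NConst 0) x s) = read_design s"
      using frame_read_design[OF f] by simp
  qed
  have cn: "ready B (set_counter 10 x s)" "read_design (set_counter 10 x s) = read_design s" if "ready B s" for x s
  proof -
    have f: "frame {2, 3, 4, 5, 8, 9, 10} {3, 4, 5, 6} s (set_counter 10 x s)"
      by (rule frame_set_counter[OF frame_refl]) simp
    show "ready B (set_counter 10 x s)" by (rule ready_frame[OF that f])
    show "read_design (set_counter 10 x s) = read_design s" using frame_read_design[OF f] by simp
  qed
  have 1: "hoare (\<lambda>s. s = s0) 1 (nset 8 up) (\<lambda>s. ready B s \<and> nmem s (8, 0, 0) = p \<and> read_design s = Y 0)"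
    by (rule hoare_NAssign) (use start in \<open>auto simp: wr exps Y0\<close>)
  have 2: "hoare (\<lambda>s. ready B s \<and> nmem s (8, 0, 0) = p \<and> read_design s = Y 0) 1 (nset 9 dn) (I 0)"
    by (rule hoare_NAssign) (auto simp: wr exps I_def)
  have 3: "hoare (I 0) (N * ((update_time d + 2) + 4) + 3) (For 10 hi (Seq (nset 2 ix) update_prog)) (I N)"
  proof (rule hoare_For)
    fix s assume "I 0 s" then show "I 0 (set_counter 10 0 s)" by (auto simp: I_def cn)
  next
    fix i s assume "I i s" then show "nval hi s = N" by (auto simp: I_def exps)
  next
    fix i assume i: "i < N"
    show "hoare (\<lambda>s. I i s \<and> nmem s (10, 0, 0) = i) (update_time d + 2) (Seq (nset 2 ix) update_prog)
          (\<lambda>s. nmem s (10, 0, 0) = i \<and> I (Suc i) (set_counter 10 (Suc i) s))"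
    proof (rule hoare_pointwise)
      fix s1 assume s1: "I i s1 \<and> nmem s1 (10, 0, 0) = i"
      then have rd: "ready B s1" and v8: "nmem s1 (8, 0, 0) = p" "nmem s1 (9, 0, 0) = q" "read_design s1 = Y i"
        by (auto simp: I_def)
      have sg: "sign_of s1 = real p - real q" by (simp add: sign_of_def v8)
      have "0 < 1 + sign_of s1 * lev d (mat_of s1) (ext_row (r i))"
        unfolding sg by (rule pos[OF i]) (use rd v8 in \<open>auto simp: ready_def\<close>)
      then have "hoare (\<lambda>s. s = s1) (update_time d + 2) (Seq (nset 2 ix) update_prog)
         (\<lambda>s. frame {1, 2, 3, 4, 7} {2, 3, 4, 5} s1 s \<and> ready B s \<and>
         read_design s = (read_design s1)(r i := read_design s1 (r i) + nmem s1 (8, 0, 0) - nmem s1 (9, 0, 0)))"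
        by (intro ready_update[OF rd _ r[OF i]]) (use s1 v8 Y(2)[OF i] in \<open>auto simp: exps(4)[OF rd]\<close>)
      then show "hoare (\<lambda>s. s = s1) (update_time d + 2) (Seq (nset 2 ix) update_prog)
          (\<lambda>s. nmem s (10, 0, 0) = i \<and> I (Suc i) (set_counter 10 (Suc i) s))"
      proof (rule hoare_conseq, goal_cases)
        case (2 s)
        then have f: "frame {1, 2, 3, 4, 7} {2, 3, 4, 5} s1 s" by blast
        show ?case using 2 s1 v8 frame_nmem[OF f] by (auto simp: I_def cn Y(1)[OF i])
      qed auto
    qed
  qed
  have "hoare (\<lambda>s. s = s0) (1 + (1 + (N * ((update_time d + 2) + 4) + 3) + 1) + 1) (load_prog up dn hi ix) (I N)"
    unfolding load_prog_def by (rule hoare_Seq[OF 1 hoare_Seq[OF 2 3]])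
  moreover have "1 + (1 + (N * ((update_time d + 2) + 4) + 3) + 1) + 1 = N * (update_time d + 6) + 7" by simp
  ultimately show ?thesis unfolding hoare_def I_def by metis
qed

text \<open>Additions have a nonnegative coefficient \<open>c\<close>, so all denominators are at
  least 1.\<close>

lemma load_vectors:
  assumes r: "ready B s0" and y: "read_design s0 = (\<lambda>x. if n \<le> x \<and> x < n + d then 1 else 0)"
  shows "\<exists>s. reach (n * (update_time d + 6) + 7) (load_prog (NV 6) (NConst 0) (NV 0) (NV 10)) s0 s \<and> ready B s \<and>
     read_design s = (\<lambda>x. if x < n then B else if n \<le> x \<and> x < n + d then 1 else 0)"
proof -
  let ?Y = "\<lambda>m x. if x < m then B else if n \<le> x \<and> x < n + d then 1 else (0 :: nat)"
  show ?thesis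
  proof (rule load_prog_correct[OF r, where p = B and q = 0 and r = "\<lambda>i. i" and Y = ?Y])
    fix i G assume "i < n" and G: "sym_inverse d (moment (n + d) ext_row (?Y i)) G"
    show "0 < 1 + (real B - real 0) * lev d G (ext_row i)" using lev_nonneg[OF G, of "ext_row i"] by (simp add: add_pos_nonneg)
  qed (use y in \<open>auto simp: ready_def fun_eq_iff\<close>)
qed

text \<open>The vectors span and are already present, so by \<open>unit_lev_less_1\<close> no
  removal makes the matrix singular.\<close>

lemma unload_units:
  assumes r: "ready B s0" and B: "0 < B"
    and y: "read_design s0 = (\<lambda>x. if x < n then B else if n \<le> x \<and> x < n + d then 1 else 0)"
  shows "\<exists>s. reach (d * (update_time d + 6) + 7) (load_prog (NConst 0) (NConst 1) dim_exp (NAdd (NV 0) (NV 10))) s0 s \<and>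
     ready B s \<and> read_design s = (\<lambda>x. if x < n then B else 0)"
proof -
  let ?Y = "\<lambda>m x. if x < n then B else if n + m \<le> x \<and> x < n + d then 1 else (0 :: nat)"
  have "\<exists>s. reach (d * (update_time d + 6) + 7) (load_prog (NConst 0) (NConst 1) dim_exp (NAdd (NV 0) (NV 10))) s0 s \<and>
     ready B s \<and> read_design s = ?Y d"
  proof (rule load_prog_correct[OF r, where p = 0 and q = 1 and r = "\<lambda>i. n + i" and Y = ?Y])
    fix i G assume i: "i < d" and G: "sym_inverse d (moment (n + d) ext_row (?Y i)) G"
    have "lev d G (ext_row (n + i)) < 1"
      by (rule unit_lev_less_1[OF G, of _ n]) (use i B ext_row_separating in auto)
    then show "0 < 1 + (real 0 - real 1) * lev d G (ext_row (n + i))" by simp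
  qed (use y in \<open>auto simp: ready_def fun_eq_iff\<close>)
  moreover have "?Y d = (\<lambda>x. if x < n then B else 0)" by auto
  ultimately show ?thesis by metis
qed

text \<open>The new trace is compared with every admissible row, which leaves the analysis free to
  choose its competitor.\<close>

lemma ready_greedy:
  assumes r: "ready B s0" and ex: "\<exists>i<n. admissible s0 i" and m1: "nmem s0 (9, 0, 0) \<le> 1"
  shows "hoare (\<lambda>s. s = s0) (greedy_time n d) greedy_prog
    (\<lambda>s. frame {1, 2, 3, 4, 5, 7, 10} {2, 3, 4, 5, 6} s0 s \<and> ready B s \<and>
      (\<forall>i<n. admissible s0 i \<longrightarrow> tr d (mat_of s) \<le> tr d (mat_of s0) + score s0 i) \<and>
      (\<exists>j<n. 0 < read_design s0 j \<and>
        read_design s = (read_design s0)(j := read_design s0 j + nmem s0 (8, 0, 0) - nmem s0 (9, 0, 0))) \<and>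
      nmem s (7, 0, 0) = nmem s0 (7, 0, 0) + nmem s0 (8, 0, 0) - nmem s0 (9, 0, 0))"
proof -
  have nd: "n = nmem s0 (0, 0, 0)" "d = nmem s0 (0, 1, 0)" and row: "row_of s0 = ext_row"
    using r by (auto simp: ready_def)
  show ?thesis
  proof (rule hoare_conseq[OF greedy_prog_correct[OF nd ex]], goal_cases)
    case (2 s)
    then obtain j where f: "frame {1, 2, 3, 4, 5, 7, 10} {2, 3, 4, 5, 6} s0 s"
      and j: "j < n" "admissible s0 j" "\<forall>i<n. admissible s0 i \<longrightarrow> score s0 j \<le> score s0 i"
      and mat: "\<forall>a<d. \<forall>b<d. mat_of s a b = rank1_update d (mat_of s0) (row_of s0 j) (sign_of s0) a b"
      and y: "read_design s = (read_design s0)(j := read_design s0 j + nmem s0 (8, 0, 0) - nmem s0 (9, 0, 0))"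
      and c: "nmem s (7, 0, 0) = nmem s0 (7, 0, 0) + nmem s0 (8, 0, 0) - nmem s0 (9, 0, 0)"
      by blast
    have pos: "0 < read_design s0 j" "0 < 1 + sign_of s0 * lev d (mat_of s0) (ext_row j)"
      using j(2) nd row by (auto simp: admissible_def)
    have le: "nmem s0 (9, 0, 0) \<le> read_design s0 j + nmem s0 (8, 0, 0)" using pos(1) m1 by simp
    have jd: "j < n + d" using j(1) by simp
    note st = ready_step[OF r f jd mat y c le]
    have "tr d (mat_of s) = tr d (mat_of s0) + score s0 j"
      using st(2) pos(2) by (simp add: score_def nd(2)[symmetric] row)
    then show ?case using f st(1) pos j y c by force
  qed auto
qed

section \<open>The growing phase\<close>

definition grow_inv :: "nat \<Rightarrow> state \<Rightarrow> bool" where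
  "grow_inv B s \<longleftrightarrow> ready B s \<and> nmem s (8, 0, 0) = 1 \<and> nmem s (9, 0, 0) = 0 \<and>
     (\<forall>i\<ge>n. read_design s i = 0) \<and> (\<forall>i<n. B \<le> read_design s i) \<and>
     n * B \<le> nmem s (7, 0, 0) \<and> nmem s (7, 0, 0) \<le> n * (B * (B + 1)) \<and>
     (\<forall>X H. (\<Sum>i<n. X i) = k \<longrightarrow> sym_inverse d (moment n ext_row X) H \<longrightarrow>
        (real (nmem s (7, 0, 0)) - real (n * B)) * (real B / (real B + 1)) * tr d (mat_of s) \<le> real k * tr d H)"

text \<open>The last clause of \<open>grow_inv\<close> bounds the trace in terms of the number of
  added vectors, which is the size minus \<open>n B\<close>. It ranges over all designs
  \<open>X\<close> because the algorithm does not know an optimal one.\<close>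

lemma grow_step:
  assumes B: "0 < B" and I: "grow_inv B s0" and lt: "nmem s0 (7, 0, 0) < n * (B * (B + 1))"
  shows "hoare (\<lambda>s. s = s0) (greedy_time n d) greedy_prog
    (\<lambda>s. grow_inv B s \<and> nmem s (7, 0, 0) = nmem s0 (7, 0, 0) + 1)"
proof -
  have r: "ready B s0" and pm: "nmem s0 (8, 0, 0) = 1" "nmem s0 (9, 0, 0) = 0"
    and out: "\<And>i. n \<le> i \<Longrightarrow> read_design s0 i = 0" and yB: "\<And>i. i < n \<Longrightarrow> B \<le> read_design s0 i"
    and cnt: "n * B \<le> nmem s0 (7, 0, 0)"
    and bnd: "\<And>X H. (\<Sum>i<n. X i) = k \<Longrightarrow> sym_inverse d (moment n ext_row X) H \<Longrightarrow>
        (real (nmem s0 (7, 0, 0)) - real (n * B)) * (real B / (real B + 1)) * tr d (mat_of s0) \<le> real k * tr d H"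
    using I by (auto simp: grow_inv_def)
  have row: "row_of s0 = ext_row" and dd: "nmem s0 (0, 1, 0) = d" using r by (auto simp: ready_def)
  have sg: "sign_of s0 = 1" by (simp add: sign_of_def pm)
  have "moment (n + d) ext_row (read_design s0) = moment n ext_row (read_design s0)"
    by (rule moment_restrict) (use out in auto)
  then have G: "sym_inverse d (moment n ext_row (read_design s0)) (mat_of s0)" using r by (simp add: ready_def)
  have adm: "admissible s0 i" if "i < n" for i
    using yB[OF that] B lev_nonneg[OF G, of "ext_row i"]
    by (simp add: admissible_def sg row dd add_pos_nonneg)
  have ex: "\<exists>i<n. admissible s0 i" using adm n_pos by blast
  have m1: "nmem s0 (9, 0, 0) \<le> 1" by (simp add: pm)
  show ?thesis
  proof (rule hoare_conseq[OF ready_greedy[OF r ex m1]], goal_cases)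
    case (2 s)
    then have f: "frame {1, 2, 3, 4, 5, 7, 10} {2, 3, 4, 5, 6} s0 s" and rs: "ready B s"
      and t: "\<forall>i<n. admissible s0 i \<longrightarrow> tr d (mat_of s) \<le> tr d (mat_of s0) + score s0 i"
      and c: "nmem s (7, 0, 0) = nmem s0 (7, 0, 0) + 1" by (auto simp: pm)
    obtain j where j: "j < n" "read_design s = (read_design s0)(j := read_design s0 j + 1)"
      using 2 by (auto simp: pm)
    have "(real (nmem s (7, 0, 0)) - real (n * B)) * (real B / (real B + 1)) * tr d (mat_of s) \<le> real k * tr d H"
      if X: "(\<Sum>i<n. X i) = k" and H: "sym_inverse d (moment n ext_row X) H" for X H
    proof -
      have kpos: "0 < k" using d_pos dk by simp
      obtain i where i: "i < n" "real B / (real B + 1) * (tr d (mat_of s0))\<^sup>2 / (real k * tr d H)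
           \<le> sqn d (mat_of s0) (ext_row i) / (1 + lev d (mat_of s0) (ext_row i))"
        using exists_good_addition[OF G H yB B d_pos X kpos] by auto
      have "tr d (mat_of s) \<le> tr d (mat_of s0) + score s0 i" using t i(1) adm by blast
      also have "\<dots> \<le> tr d (mat_of s0) - real B / (real B + 1) * (tr d (mat_of s0))\<^sup>2 / (real k * tr d H)"
        using i(2) by (simp add: score_def sg row dd)
      finally have new: "tr d (mat_of s) \<le> \<dots>" .
      \<comment> \<open>The recurrence is used with \<open>m\<close> the number of vectors added so
        far and \<open>K = k tr H\<close>.\<close>
      have "(real (nmem s0 (7, 0, 0)) - real (n * B) + 1) * (real B / (real B + 1)) * tr d (mat_of s) \<le> real k * tr d H"
        by (rule greedy_addition_recurrence[OF _ _ _ _ bnd[OF X H] new])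
          (use kpos tr_pos[OF H d_pos] tr_nonneg[OF G] cnt in \<open>auto simp flip: of_nat_mult\<close>)
      then show ?thesis by (simp add: c algebra_simps)
    qed
    moreover have "B \<le> read_design s i" if "i < n" for i using yB[OF that] by (auto simp: j(2))
    ultimately show ?case unfolding grow_inv_def
      using rs c lt cnt j out frame_nmem[OF f] pm by auto
  qed auto
qed

lemma grow_loop:
  assumes B: "0 < B" and r: "ready B s0" and y: "read_design s0 = (\<lambda>x. if x < n then B else 0)"
  shows "\<exists>s. reach (n * (B * (B + 1)) * (greedy_time n d + 2) + 5) (greedy_loop (NConst 1) (NConst 0)
            (RLess (OfNat (NV 7)) (RMul (OfNat (NV 0)) (RMul (OfNat (NV 6)) (RAdd (OfNat (NV 6)) (OfNat (NConst 1))))))) s0 s \<and>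
     grow_inv B s \<and> nmem s (7, 0, 0) = n * (B * (B + 1))"
proof -
  let ?N = "n * (B * (B + 1))"
  let ?b = "RLess (OfNat (NV 7)) (RMul (OfNat (NV 0)) (RMul (OfNat (NV 6)) (RAdd (OfNat (NV 6)) (OfNat (NConst 1)))))"
  define J where "J = (\<lambda>m s. grow_inv B s \<and> m = ?N - nmem s (7, 0, 0))"
  have test: "bval ?b s \<longleftrightarrow> nmem s (7, 0, 0) < ?N" if "grow_inv B s" for s
  proof -
    have "nmem s (0, 0, 0) = n" "nmem s (6, 0, 0) = B" using that by (auto simp: grow_inv_def ready_def)
    then have "bval ?b s \<longleftrightarrow> real (nmem s (7, 0, 0)) < real ?N" by simp
    then show ?thesis by (simp only: of_nat_less_iff)
  qed
  have step: "hoare (\<lambda>s. J m s \<and> bval ?b s) (greedy_time n d) greedy_prog (\<lambda>s. \<exists>m'<m. J m' s)" for m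
  proof (rule hoare_pointwise)
    fix s1 assume s1: "J m s1 \<and> bval ?b s1"
    then have I: "grow_inv B s1" and lt: "nmem s1 (7, 0, 0) < ?N" using test by (auto simp: J_def)
    show "hoare (\<lambda>s. s = s1) (greedy_time n d) greedy_prog (\<lambda>s. \<exists>m'<m. J m' s)"
      by (rule hoare_conseq[OF grow_step[OF B I lt]]) (use s1 lt in \<open>auto simp: J_def\<close>)
  qed
  define s1 where "s1 = nwrite 9 (NConst 0) (NConst 0) 0 (nwrite 8 (NConst 0) (NConst 0) 1 s0)"
  have f: "frame {2, 3, 4, 5, 8, 9, 10} {3, 4, 5, 6} s0 s1"
    unfolding s1_def by (intro frame_nwrite frame_refl) auto
  have y1: "read_design s1 = (\<lambda>x. if x < n then B else 0)" using frame_read_design[OF f] y by simp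
  have r1: "ready B s1" by (rule ready_frame[OF r f])
  have "(\<Sum>i<n + d. if i < n then B else 0) = (\<Sum>i<n. B)"
    by (intro sum.mono_neutral_cong_right) auto
  then have c1: "nmem s1 (7, 0, 0) = n * B" using r1 y1 by (simp add: ready_def)
  have nonneg: "0 \<le> tr d H" if "sym_inverse d (moment n ext_row X) H" for X H by (rule tr_nonneg[OF that])
  have pm: "nmem s1 (8, 0, 0) = 1" "nmem s1 (9, 0, 0) = 0" unfolding s1_def by auto
  \<comment> \<open>Nothing has been added yet, so the factor in front of the trace is zero.\<close>
  have I1: "grow_inv B s1"
    unfolding grow_inv_def using r1 pm nonneg by (simp add: c1 y1)
  have J1: "J (?N - n * B) s1" using I1 c1 by (simp add: J_def)
  obtain s2 where s2: "reach ((?N - n * B) * (greedy_time n d + 2) + 1) (While ?b greedy_prog) s1 s2"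
      "(\<exists>m'\<le>?N - n * B. J m' s2) \<and> \<not> bval ?b s2"
    using hoareE[OF hoare_While[of J, OF step], OF J1] by blast
  have I2: "grow_inv B s2" using s2(2) by (auto simp: J_def)
  have "nmem s2 (7, 0, 0) = ?N" using I2 s2(2) test[OF I2] unfolding grow_inv_def by auto
  moreover have "reach (?N * (greedy_time n d + 2) + 5) (greedy_loop (NConst 1) (NConst 0) ?b) s0 s2"
  proof -
    have a: "reach 1 (nset 8 (NConst 1)) s0 (nwrite 8 (NConst 0) (NConst 0) 1 s0)" by (simp add: One_nat_def)
    have b: "reach 1 (nset 9 (NConst 0)) (nwrite 8 (NConst 0) (NConst 0) 1 s0) s1"
      unfolding s1_def by (simp add: One_nat_def)
    have "(?N - n * B) * (greedy_time n d + 2) \<le> ?N * (greedy_time n d + 2)" by (intro mult_right_mono) auto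
    then show ?thesis unfolding greedy_loop_def
      by (intro reach_mono[OF reach_Seq[OF a reach_Seq[OF b s2(1)]]]) linarith
  qed
  ultimately show ?thesis using I2 by blast
qed

section \<open>The shrinking phase\<close>

definition shrink_inv :: "nat \<Rightarrow> state \<Rightarrow> bool" where
  "shrink_inv B s \<longleftrightarrow> ready B s \<and> nmem s (8, 0, 0) = 0 \<and> nmem s (9, 0, 0) = 1 \<and>
     (\<forall>i\<ge>n. read_design s i = 0) \<and> k \<le> nmem s (7, 0, 0) \<and>
     (\<forall>X H. (\<Sum>i<n. X i) = k \<longrightarrow> sym_inverse d (moment n ext_row X) H \<longrightarrow>
        tr d (mat_of s) * (real (nmem s (7, 0, 0)) - real d + 1) * (real B)\<^sup>2 \<le> real k * tr d H * (real B + 1)\<^sup>2)"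

text \<open>Removing the row from \<open>exists_cheap_removal\<close> gives
  \<open>f' x <= f (x + 1)\<close> with \<open>x = s - d\<close>, which is the bound for size
  \<open>s - 1\<close>; the greedy choice does at least as well.\<close>

lemma shrink_step:
  assumes I: "shrink_inv B s0" and lt: "k < nmem s0 (7, 0, 0)"
  shows "hoare (\<lambda>s. s = s0) (greedy_time n d) greedy_prog
    (\<lambda>s. shrink_inv B s \<and> nmem s (7, 0, 0) = nmem s0 (7, 0, 0) - 1)"
proof -
  have r: "ready B s0" and pm: "nmem s0 (8, 0, 0) = 0" "nmem s0 (9, 0, 0) = 1"
    and out: "\<And>i. n \<le> i \<Longrightarrow> read_design s0 i = 0"
    and bnd: "\<And>X H. (\<Sum>i<n. X i) = k \<Longrightarrow> sym_inverse d (moment n ext_row X) H \<Longrightarrow>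
        tr d (mat_of s0) * (real (nmem s0 (7, 0, 0)) - real d + 1) * (real B)\<^sup>2 \<le> real k * tr d H * (real B + 1)\<^sup>2"
    using I by (auto simp: shrink_inv_def)
  have row: "row_of s0 = ext_row" and dd: "nmem s0 (0, 1, 0) = d"
    and G: "sym_inverse d (moment (n + d) ext_row (read_design s0)) (mat_of s0)"
    and c0: "nmem s0 (7, 0, 0) = (\<Sum>i<n + d. read_design s0 i)"
    using r by (auto simp: ready_def)
  have sg: "sign_of s0 = -1" by (simp add: sign_of_def pm)
  have "d < (\<Sum>i<n + d. read_design s0 i)" using lt dk c0 by simp
  then obtain i where i: "i < n + d" "0 < read_design s0 i" "0 < 1 - lev d (mat_of s0) (ext_row i)"
      "sqn d (mat_of s0) (ext_row i) / (1 - lev d (mat_of s0) (ext_row i))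
         \<le> tr d (mat_of s0) / (real (nmem s0 (7, 0, 0)) - real d)"
    using exists_cheap_removal[OF G d_pos] unfolding c0 by auto
  \<comment> \<open>Unit rows have multiplicity zero by now, so the row is one of the given
    vectors.\<close>
  have i_n: "i < n" using i(2) out[of i] by (cases "i < n") auto
  have adm: "admissible s0 i" using i by (simp add: admissible_def sg row dd)
  have ex: "\<exists>i<n. admissible s0 i" using adm i_n by blast
  have m1: "nmem s0 (9, 0, 0) \<le> 1" by (simp add: pm)
  show ?thesis
  proof (rule hoare_conseq[OF ready_greedy[OF r ex m1]], goal_cases)
    case (2 s)
    then have f: "frame {1, 2, 3, 4, 5, 7, 10} {2, 3, 4, 5, 6} s0 s" and rs: "ready B s"
      and t: "\<forall>i<n. admissible s0 i \<longrightarrow> tr d (mat_of s) \<le> tr d (mat_of s0) + score s0 i"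
      and c: "nmem s (7, 0, 0) = nmem s0 (7, 0, 0) - 1" by (auto simp: pm)
    obtain j where j: "j < n" "read_design s = (read_design s0)(j := read_design s0 j - 1)"
      using 2 by (auto simp: pm)
    let ?x = "real (nmem s0 (7, 0, 0)) - real d"
    have x: "0 < ?x" using lt dk by simp
    have "tr d (mat_of s) \<le> tr d (mat_of s0) + score s0 i" using t i_n adm by blast
    also have "\<dots> \<le> tr d (mat_of s0) + tr d (mat_of s0) / ?x"
      using i(4) by (simp add: score_def sg row dd)
    finally have "tr d (mat_of s) * ?x \<le> (tr d (mat_of s0) + tr d (mat_of s0) / ?x) * ?x"
      using x by (intro mult_right_mono) auto
    also have "\<dots> = tr d (mat_of s0) * (?x + 1)" using x by (simp add: field_simps)
    finally have "tr d (mat_of s) * ?x * (real B)\<^sup>2 \<le> tr d (mat_of s0) * (?x + 1) * (real B)\<^sup>2"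
      by (rule mult_right_mono) simp
    then have shrunk: "tr d (mat_of s) * (real (nmem s (7, 0, 0)) - real d + 1) * (real B)\<^sup>2
        \<le> tr d (mat_of s0) * (?x + 1) * (real B)\<^sup>2" using lt by (simp add: c of_nat_diff)
    have "tr d (mat_of s) * (real (nmem s (7, 0, 0)) - real d + 1) * (real B)\<^sup>2 \<le> real k * tr d H * (real B + 1)\<^sup>2"
      if X: "(\<Sum>i<n. X i) = k" and H: "sym_inverse d (moment n ext_row X) H" for X H
      using shrunk bnd[OF X H] by (rule order_trans)
    then show ?case unfolding shrink_inv_def
      using rs c lt j out frame_nmem[OF f] pm by auto
  qed auto
qed

lemma shrink_loop:
  assumes B: "0 < B" and I: "grow_inv B s0" and c: "nmem s0 (7, 0, 0) = n * (B * (B + 1))" and kB: "k \<le> B"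
  shows "\<exists>s. reach (n * (B * (B + 1)) * (greedy_time n d + 2) + 5)
      (greedy_loop (NConst 0) (NConst 1) (NLess k_exp (NV 7))) s0 s \<and>
     shrink_inv B s \<and> nmem s (7, 0, 0) = k"
proof -
  let ?N = "n * (B * (B + 1))"
  let ?b = "NLess k_exp (NV 7)"
  define J where "J = (\<lambda>m s. shrink_inv B s \<and> m = nmem s (7, 0, 0) - k)"
  have test: "bval ?b s \<longleftrightarrow> k < nmem s (7, 0, 0)" if "shrink_inv B s" for s
    using that by (simp add: shrink_inv_def ready_def)
  have step: "hoare (\<lambda>s. J m s \<and> bval ?b s) (greedy_time n d) greedy_prog (\<lambda>s. \<exists>m'<m. J m' s)" for m
  proof (rule hoare_pointwise)
    fix s1 assume s1: "J m s1 \<and> bval ?b s1"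
    then have I: "shrink_inv B s1" and lt: "k < nmem s1 (7, 0, 0)" using test by (auto simp: J_def)
    show "hoare (\<lambda>s. s = s1) (greedy_time n d) greedy_prog (\<lambda>s. \<exists>m'<m. J m' s)"
      by (rule hoare_conseq[OF shrink_step[OF I lt]]) (use s1 lt in \<open>auto simp: J_def\<close>)
  qed
  define s1 where "s1 = nwrite 9 (NConst 0) (NConst 0) 1 (nwrite 8 (NConst 0) (NConst 0) 0 s0)"
  have f: "frame {2, 3, 4, 5, 8, 9, 10} {3, 4, 5, 6} s0 s1"
    unfolding s1_def by (intro frame_nwrite frame_refl) auto
  have y1: "read_design s1 = read_design s0" using frame_read_design[OF f] by simp
  have m1: "mat_of s1 = mat_of s0" using frame_mat_of[OF f] by simp
  have r1: "ready B s1" by (rule ready_frame[OF _ f]) (use I in \<open>auto simp: grow_inv_def\<close>)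
  have c1: "nmem s1 (7, 0, 0) = ?N" using c frame_nmem[OF f] by simp
  have pm: "nmem s1 (8, 0, 0) = 0" "nmem s1 (9, 0, 0) = 1" unfolding s1_def by auto
  \<comment> \<open>With \<open>k <= B\<close> this shows that growing ended at a size of at least
    \<open>k\<close>.\<close>
  have "1 * (B * 1) \<le> ?N" using n_pos by (intro mult_mono) auto
  then have kN: "k \<le> ?N" using kB by (simp only: mult_1 mult_1_right)
  have "tr d (mat_of s1) * (real ?N - real d + 1) * (real B)\<^sup>2 \<le> real k * tr d H * (real B + 1)\<^sup>2"
    if X: "(\<Sum>i<n. X i) = k" and H: "sym_inverse d (moment n ext_row X) H" for X H
  proof -
    have t0: "0 \<le> tr d (mat_of s1)" using r1 tr_nonneg unfolding ready_def by blast
    have "(real ?N - real (n * B)) * (real B / (real B + 1)) * tr d (mat_of s0) \<le> real k * tr d H"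
      using I X H c unfolding grow_inv_def by (metis (no_types, lifting))
    then have "((real ?N - real (n * B)) * (real B / (real B + 1)) * tr d (mat_of s0)) * (real B + 1)\<^sup>2
        \<le> real k * tr d H * (real B + 1)\<^sup>2" by (rule mult_right_mono) simp
    \<comment> \<open>\<open>N - n B = n B^2\<close> for \<open>N = n B (B + 1)\<close>, so the left
      side collapses to the trace times \<open>N B^2\<close>.\<close>
    moreover have "((real ?N - real (n * B)) * (real B / (real B + 1)) * tr d (mat_of s0)) * (real B + 1)\<^sup>2
        = tr d (mat_of s1) * real ?N * (real B)\<^sup>2"
    proof -
      have "real B + 1 \<noteq> 0" using B by simp
      then have "(real B / (real B + 1)) * (real B + 1)\<^sup>2 = real B * (real B + 1)"
        by (simp add: power2_eq_square)
      moreover have "x * c * t * q = x * t * (c * q)" for x c t q :: real by simp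
      ultimately have "((real ?N - real (n * B)) * (real B / (real B + 1)) * tr d (mat_of s0)) * (real B + 1)\<^sup>2
         = (real ?N - real (n * B)) * tr d (mat_of s0) * (real B * (real B + 1))"
        by (simp only:)
      then show ?thesis by (simp add: m1 algebra_simps power2_eq_square)
    qed
    \<comment> \<open>\<open>d >= 1\<close> allows bounding \<open>N - d + 1\<close> by
      \<open>N\<close>.\<close>
    moreover have "tr d (mat_of s1) * (real ?N - real d + 1) * (real B)\<^sup>2 \<le> tr d (mat_of s1) * real ?N * (real B)\<^sup>2"
      using t0 d_pos by (intro mult_right_mono mult_left_mono) auto
    ultimately show ?thesis by linarith
  qed
  then have I1: "shrink_inv B s1"
    using I r1 pm y1 c1 kN by (auto simp: shrink_inv_def grow_inv_def)
  have J1: "J (?N - k) s1" using I1 c1 by (simp add: J_def)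
  obtain s2 where s2: "reach ((?N - k) * (greedy_time n d + 2) + 1) (While ?b greedy_prog) s1 s2"
      "(\<exists>m'\<le>?N - k. J m' s2) \<and> \<not> bval ?b s2"
    using hoareE[OF hoare_While[of J, OF step], OF J1] by blast
  have I2: "shrink_inv B s2" using s2(2) by (auto simp: J_def)
  have "nmem s2 (7, 0, 0) = k" using I2 s2(2) test[OF I2] unfolding shrink_inv_def by auto
  moreover have "reach (?N * (greedy_time n d + 2) + 5) (greedy_loop (NConst 0) (NConst 1) ?b) s0 s2"
  proof -
    have a: "reach 1 (nset 8 (NConst 0)) s0 (nwrite 8 (NConst 0) (NConst 0) 0 s0)" by (simp add: One_nat_def)
    have b: "reach 1 (nset 9 (NConst 1)) (nwrite 8 (NConst 0) (NConst 0) 0 s0) s1"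
      unfolding s1_def by (simp add: One_nat_def)
    have "(?N - k) * (greedy_time n d + 2) \<le> ?N * (greedy_time n d + 2)" by (intro mult_right_mono) auto
    then show ?thesis unfolding greedy_loop_def
      by (intro reach_mono[OF reach_Seq[OF a reach_Seq[OF b s2(1)]]]) linarith
  qed
  ultimately show ?thesis using I2 by blast
qed

section \<open>Translation between coordinate inverses and the objective function\<close>

lemma info_mat_eq_moment:
  assumes "a < d" "b < d"
  shows "info_mat n d v X $$ (a, b) = moment n ext_row X a b"
  using assms unfolding info_mat_def moment_def ext_row_def by (auto intro!: sum.cong)

lemma a_value_eq:
  assumes inv: "sym_inverse d (moment n ext_row X) G"
  shows "a_value n d v X = ennreal (tr d G)"
proof -
  let ?C = "mat d d (\<lambda>(a, b). G a b)"
  have A: "info_mat n d v X \<in> carrier_mat d d" unfolding info_mat_def by simp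
  have "?C * info_mat n d v X = 1\<^sub>m d"
  proof (rule eq_matI)
    fix i j assume "i < dim_row (1\<^sub>m d :: real mat)" "j < dim_col (1\<^sub>m d :: real mat)"
    then have ij: "i < d" "j < d" by auto
    have "(?C * info_mat n d v X) $$ (i, j) = (\<Sum>b<d. G i b * moment n ext_row X b j)"
      using ij A by (auto simp: scalar_prod_def atLeast0LessThan info_mat_eq_moment[symmetric] intro!: sum.cong)
    also have "\<dots> = (if i = j then 1 else 0)" using inv ij unfolding sym_inverse_def by blast
    finally show "(?C * info_mat n d v X) $$ (i, j) = 1\<^sub>m d $$ (i, j)" using ij by simp
  qed (use A in auto)
  then have "mat_inverse (info_mat n d v X) = Some ?C"
    by (intro mat_inverse_unique[OF A]) auto
  then show ?thesis unfolding a_value_def mat_trace_def tr_def by (simp add: atLeast0LessThan)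
qed

text \<open>The information matrix is symmetric, so the transpose of its inverse is an inverse too,
  and uniqueness makes the inverse symmetric.\<close>

lemma a_value_finiteE:
  assumes "a_value n d v X \<noteq> \<infinity>"
  obtains H where "sym_inverse d (moment n ext_row X) H"
proof -
  let ?A = "info_mat n d v X"
  have A: "?A \<in> carrier_mat d d" unfolding info_mat_def by simp
  obtain C where "mat_inverse ?A = Some C" using assms unfolding a_value_def by (auto split: option.splits)
  then have C: "?A * C = 1\<^sub>m d" "C * ?A = 1\<^sub>m d" "C \<in> carrier_mat d d" using mat_inverse(2)[OF A] by auto
  have symA: "transpose_mat ?A = ?A"
    by (rule eq_matI) (auto simp: info_mat_def mult.commute)
  have "transpose_mat C * ?A = 1\<^sub>m d"
    using transpose_mult[OF A C(3)] C(1) symA by simp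
  then have "mat_inverse ?A = Some (transpose_mat C)" using A C(3) by (intro mat_inverse_unique) auto
  then have CT: "transpose_mat C = C" using \<open>mat_inverse ?A = Some C\<close> by simp
  have "sym_inverse d (moment n ext_row X) (\<lambda>a b. C $$ (a, b))"
    unfolding sym_inverse_def
  proof (intro conjI allI impI)
    fix a b assume "a < d" "b < d"
    then show "C $$ (a, b) = C $$ (b, a)"
      using C(3) CT by (metis carrier_matD index_transpose_mat(1))
    have "(\<Sum>x<d. C $$ (a, x) * moment n ext_row X x b) = (C * ?A) $$ (a, b)"
      using \<open>a < d\<close> \<open>b < d\<close> A C(3)
      by (auto simp: scalar_prod_def atLeast0LessThan info_mat_eq_moment[symmetric] intro!: sum.cong)
    then show "(\<Sum>x<d. C $$ (a, x) * moment n ext_row X x b) = (if a = b then 1 else 0)"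
      using C(2) \<open>a < d\<close> \<open>b < d\<close> by simp
  qed
  then show ?thesis by (rule that)
qed

section \<open>Initialization and the choice of \<open>B\<close>\<close>

definition max_copies :: nat where
  "max_copies = nat \<lceil>6 * real k / \<epsilon>\<rceil> + 1"

text \<open>The unit rows alone have the identity as information matrix, which is its own
  inverse.\<close>

lemma moment_units:
  assumes "a < d" "b < d"
  shows "moment (n + d) ext_row (\<lambda>x. if n \<le> x \<and> x < n + d then 1 else 0) a b = (if a = b then 1 else 0)"
proof -
  have "moment (n + d) ext_row (\<lambda>x. if n \<le> x \<and> x < n + d then 1 else 0) a b
     = (\<Sum>i<n + d. if i = n + a then (if a = b then 1 else 0) else 0)"
    unfolding moment_def ext_row_def using assms by (intro sum.cong) auto
  then show ?thesis using assms by simp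
qed

lemma init_prog_correct:
  "\<exists>s B. reach (9 * d + 3 * max_copies + 10) init_prog (input_state n d k \<epsilon> v) s \<and> ready B s \<and>
     read_design s = (\<lambda>x. if n \<le> x \<and> x < n + d then 1 else 0) \<and>
     0 < B \<and> B \<le> max_copies \<and> 6 * real k \<le> real B * \<epsilon>"
proof -
  let ?y = "\<lambda>m x. if n \<le> x \<and> x < n + m then 1 else (0 :: nat)"
  define hdr where "hdr = (\<lambda>s :: state. nmem s (0, 0, 0) = n \<and> nmem s (0, 1, 0) = d \<and> nmem s (0, 2, 0) = k \<and> rmem s (0, 0, 0) = \<epsilon>)"
  define I where "I = (\<lambda>m s. hdr s \<and>
     (\<forall>i b. rmem s (1, i, b) = (if i < n then (if b < d then vec_index (v i) b else 0)
                                else if i < n + m \<and> i = n + b then 1 else 0)) \<and>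
     (\<forall>a b. rmem s (2, a, b) = (if a < m \<and> a = b then 1 else 0)) \<and>
     (\<forall>x. nmem s (1, x, 0) = ?y m x))"
  have I0: "I 0 (set_counter 3 0 s)" if "s = input_state n d k \<epsilon> v" for s
    unfolding that I_def hdr_def input_state_def by auto
  \<comment> \<open>The state after the first of the three writes, when only the stored rows have
    advanced.\<close>
  define rowp where "rowp = (\<lambda>m s. hdr s \<and> nmem s (3, 0, 0) = m \<and>
     (\<forall>i b. rmem s (1, i, b) = (if i < n then (if b < d then vec_index (v i) b else 0)
                                else if i < n + Suc m \<and> i = n + b then 1 else 0)))"
  have body: "hoare (\<lambda>s. I m s \<and> nmem s (3, 0, 0) = m) (1 + (1 + 1 + 1) + 1)
       (Seq (RAssign 1 (NAdd (NV 0) (NV 3)) (NV 3) (OfNat (NConst 1)))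
       (Seq (RAssign 2 (NV 3) (NV 3) (OfNat (NConst 1)))
            (NAssign 1 (NAdd (NV 0) (NV 3)) (NConst 0) (NConst 1))))
       (\<lambda>s. nmem s (3, 0, 0) = m \<and> I (Suc m) (set_counter 3 (Suc m) s))" if "m < d" for m
  proof (rule hoare_Seq[where Q = "\<lambda>s. rowp m s \<and> (\<forall>a b. rmem s (2, a, b) = (if a < m \<and> a = b then 1 else 0)) \<and>
     (\<forall>x. nmem s (1, x, 0) = ?y m x)"], goal_cases)
    case 1
    show ?case by (rule hoare_RAssign) (auto simp: I_def rowp_def hdr_def)
  next
    case 2
    show ?case
    proof (rule hoare_Seq[where Q = "\<lambda>s. rowp m s \<and> (\<forall>a b. rmem s (2, a, b) = (if a < Suc m \<and> a = b then 1 else 0)) \<and>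
     (\<forall>x. nmem s (1, x, 0) = ?y m x)"], goal_cases)
      case 1
      show ?case by (rule hoare_RAssign) (auto simp: rowp_def hdr_def)
    next
      case 2
      show ?case by (rule hoare_NAssign) (auto simp: rowp_def hdr_def I_def)
    qed
  qed
  have loop: "hoare (\<lambda>s. s = input_state n d k \<epsilon> v) (d * ((1 + (1 + 1 + 1) + 1) + 4) + 3)
     (For 3 dim_exp (Seq (RAssign 1 (NAdd (NV 0) (NV 3)) (NV 3) (OfNat (NConst 1)))
       (Seq (RAssign 2 (NV 3) (NV 3) (OfNat (NConst 1)))
            (NAssign 1 (NAdd (NV 0) (NV 3)) (NConst 0) (NConst 1))))) (I d)"
    by (rule hoare_For[OF I0 body]) (auto simp: I_def hdr_def)
  \<comment> \<open>The variant is \<open>max_copies - B\<close>: while the test holds,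
    \<open>B\<close> is below \<open>6 k / \<epsilon>\<close> and hence below
    \<open>max_copies\<close>.\<close>
  define J where "J = (\<lambda>m s. \<exists>B. ready B s \<and> rmem s (0, 0, 0) = \<epsilon> \<and> read_design s = ?y d \<and> 0 < B \<and> m + B = max_copies)"
  have seven: "hoare (I d) 1 (nset 7 dim_exp) (\<lambda>s. I d s \<and> nmem s (7, 0, 0) = d)"
    by (rule hoare_NAssign) (auto simp: I_def hdr_def)
  have "(\<Sum>i<n + d. ?y d i) = (\<Sum>i\<in>{n..<n + d}. 1)" by (intro sum.mono_neutral_cong_right) auto
  then have sumy: "(\<Sum>i<n + d. ?y d i) = d" by simp
  have six: "hoare (\<lambda>s. I d s \<and> nmem s (7, 0, 0) = d) 1 (nset 6 (NConst 1)) (J (max_copies - 1))"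
  proof (rule hoare_NAssign, goal_cases)
    case (1 s)
    let ?s = "nwrite 6 (NConst 0) (NConst 0) 1 s"
    have y: "read_design ?s = ?y d" using 1 unfolding read_design_def I_def by auto
    have row: "row_of ?s = ext_row" using 1 unfolding row_of_def I_def ext_row_def fun_eq_iff by simp
    have mt: "mat_of ?s a b = (if a < d \<and> a = b then 1 else 0)" for a b
      using 1 unfolding mat_of_def I_def by simp
    have "(\<Sum>b<d. mat_of ?s a b * moment (n + d) ext_row (?y d) b c) = (if a = c then 1 else 0)"
      if ac: "a < d" "c < d" for a c
    proof -
      have "(\<Sum>b<d. mat_of ?s a b * moment (n + d) ext_row (?y d) b c)
         = (\<Sum>b<d. if b = a then (if a = c then 1 else 0) else 0)"
        using ac by (intro sum.cong) (auto simp: mt moment_units)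
      then show ?thesis using ac by simp
    qed
    then have "sym_inverse d (moment (n + d) ext_row (read_design ?s)) (mat_of ?s)"
      unfolding sym_inverse_def y by (auto simp: mt)
    then have "ready 1 ?s" using 1 sumy row unfolding ready_def y by (simp add: I_def hdr_def)
    moreover have "rmem ?s (0, 0, 0) = \<epsilon>" using 1 by (simp add: I_def hdr_def)
    moreover have "max_copies - 1 + 1 = max_copies" by (simp add: max_copies_def)
    ultimately show ?case unfolding J_def nval.simps using y by (intro exI[of _ 1]) simp
  qed
  let ?b = "RLess (RMul (OfNat (NV 6)) (RV 0)) (RMul (OfNat (NConst 6)) (OfNat k_exp))"
  have test: "bval ?b s \<longleftrightarrow> real B * \<epsilon> < 6 * real k" if "ready B s" "rmem s (0, 0, 0) = \<epsilon>" for B s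
    using that by (simp add: ready_def)
  have step: "hoare (\<lambda>s. J m s \<and> bval ?b s) 1 (nset 6 (NAdd (NV 6) (NConst 1))) (\<lambda>s. \<exists>m'<m. J m' s)" for m
  proof (rule hoare_NAssign, goal_cases)
    case (1 s)
    let ?s = "nwrite 6 (NConst 0) (NConst 0) (nval (NAdd (NV 6) (NConst 1)) s) s"
    obtain B where B: "ready B s" "rmem s (0, 0, 0) = \<epsilon>" "read_design s = ?y d" "0 < B" "m + B = max_copies"
      using 1 by (auto simp: J_def)
    have "real B * \<epsilon> < 6 * real k" using 1 test[OF B(1,2)] by blast
    then have "real B < 6 * real k / \<epsilon>" using eps by (simp add: field_simps)
    then have "B < max_copies" unfolding max_copies_def by linarith
    then have m: "0 < m" using B(5) by simp
    have same: "mat_of ?s = mat_of s" "row_of ?s = row_of s" "read_design ?s = read_design s"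
      by (auto simp: mat_of_def row_of_def read_design_def fun_eq_iff)
    have "ready (B + 1) ?s" using B(1) same by (simp add: ready_def)
    then have "J (m - 1) ?s" unfolding J_def using B same m by (intro exI[of _ "B + 1"]) auto
    then show ?case using m by (intro exI[of _ "m - 1"]) auto
  qed
  have "hoare (\<lambda>s. s = input_state n d k \<epsilon> v)
     ((d * ((1 + (1 + 1 + 1) + 1) + 4) + 3) + (1 + (1 + ((max_copies - 1) * (1 + 2) + 1) + 1) + 1) + 1) init_prog
     (\<lambda>s. (\<exists>m\<le>max_copies - 1. J m s) \<and> \<not> bval ?b s)"
    unfolding init_prog_def
    by (rule hoare_Seq[OF loop hoare_Seq[OF seven hoare_Seq[OF six hoare_While[of J, OF step]]]])
  then obtain s where s: "reach ((d * ((1 + (1 + 1 + 1) + 1) + 4) + 3) + (1 + (1 + ((max_copies - 1) * (1 + 2) + 1) + 1) + 1) + 1)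
      init_prog (input_state n d k \<epsilon> v) s" "(\<exists>m\<le>max_copies - 1. J m s) \<and> \<not> bval ?b s"
    by (rule hoareE) simp
  obtain m B where B: "ready B s" "rmem s (0, 0, 0) = \<epsilon>" "read_design s = ?y d" "0 < B" "m + B = max_copies"
    using s(2) by (auto simp: J_def)
  have "6 * real k \<le> real B * \<epsilon>" using s(2) test[OF B(1,2)] by (simp del: bval.simps)
  moreover have "reach (9 * d + 3 * max_copies + 10) init_prog (input_state n d k \<epsilon> v) s"
    by (rule reach_mono[OF s(1)]) (simp add: max_copies_def)
  ultimately show ?thesis using B by (intro exI[of _ s] exI[of _ B]) auto
qed

section \<open>Composition of the phases and the approximation guarantee\<close>

definition total_time :: nat where
  "total_time = 9 * d + 3 * max_copies + 10 + (n * (update_time d + 6) + 7) + (d * (update_time d + 6) + 7)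
     + 2 * (n * (max_copies * (max_copies + 1)) * (greedy_time n d + 2) + 5) + 4"

lemma design_prog_correct:
  assumes "\<epsilon> \<le> 1"
  shows "\<exists>s B G. reach total_time design_prog (input_state n d k \<epsilon> v) s \<and>
     0 < B \<and> 6 * real k \<le> real B * \<epsilon> \<and> (\<Sum>i<n. read_design s i) = k \<and>
     sym_inverse d (moment n ext_row (read_design s)) G \<and>
     (\<forall>X H. (\<Sum>i<n. X i) = k \<longrightarrow> sym_inverse d (moment n ext_row X) H \<longrightarrow>
        tr d G * (real k - real d + 1) * (real B)\<^sup>2 \<le> real k * tr d H * (real B + 1)\<^sup>2)"
proof -
  obtain s1 B where s1: "reach (9 * d + 3 * max_copies + 10) init_prog (input_state n d k \<epsilon> v) s1" "ready B s1"
     "read_design s1 = (\<lambda>x. if n \<le> x \<and> x < n + d then 1 else 0)"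
     and B: "0 < B" "B \<le> max_copies" "6 * real k \<le> real B * \<epsilon>"
    using init_prog_correct by blast
  \<comment> \<open>\<open>\<epsilon> <= 1\<close> gives \<open>6 k <= B\<close>, hence the
    \<open>k <= B\<close> on which the shrinking phase relies.\<close>
  have "real B * \<epsilon> \<le> real B * 1" using assms by (intro mult_left_mono) auto
  then have kB: "k \<le> B" using B(3) by linarith
  obtain s2 where s2: "reach (n * (update_time d + 6) + 7) (load_prog (NV 6) (NConst 0) (NV 0) (NV 10)) s1 s2" "ready B s2"
     "read_design s2 = (\<lambda>x. if x < n then B else if n \<le> x \<and> x < n + d then 1 else 0)"
    using load_vectors[OF s1(2,3)] by blast
  obtain s3 where s3: "reach (d * (update_time d + 6) + 7) (load_prog (NConst 0) (NConst 1) dim_exp (NAdd (NV 0) (NV 10))) s2 s3"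
     "ready B s3" "read_design s3 = (\<lambda>x. if x < n then B else 0)"
    using unload_units[OF s2(2) B(1) s2(3)] by blast
  let ?T = "n * (B * (B + 1)) * (greedy_time n d + 2) + 5"
  obtain s4 where s4: "reach ?T (greedy_loop (NConst 1) (NConst 0)
            (RLess (OfNat (NV 7)) (RMul (OfNat (NV 0)) (RMul (OfNat (NV 6)) (RAdd (OfNat (NV 6)) (OfNat (NConst 1))))))) s3 s4"
     "grow_inv B s4" "nmem s4 (7, 0, 0) = n * (B * (B + 1))"
    using grow_loop[OF B(1) s3(2,3)] by blast
  obtain s5 where s5: "reach ?T (greedy_loop (NConst 0) (NConst 1) (NLess k_exp (NV 7))) s4 s5"
     "shrink_inv B s5" "nmem s5 (7, 0, 0) = k"
    using shrink_loop[OF B(1) s4(2,3) kB] by blast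
  have T: "?T \<le> n * (max_copies * (max_copies + 1)) * (greedy_time n d + 2) + 5"
    using B(2) by (intro add_right_mono mult_right_mono mult_left_mono mult_mono) auto
  have run: "reach total_time design_prog (input_state n d k \<epsilon> v) s5"
    unfolding design_prog_def
  proof (rule reach_mono[OF reach_Seq[OF s1(1) reach_Seq[OF s2(1) reach_Seq[OF s3(1) reach_Seq[OF s4(1) s5(1)]]]]], goal_cases)
    case 1
    have gen: "a + (b + (c + (x + x + 1) + 1) + 1) + 1 \<le> a + b + c + 2 * y + 4" if "x \<le> y" for a b c x y :: nat
      using that by simp
    show ?case unfolding total_time_def by (rule gen[OF T])
  qed
  have r5: "ready B s5" and out: "\<And>i. n \<le> i \<Longrightarrow> read_design s5 i = 0"
    and bnd: "\<And>X H. (\<Sum>i<n. X i) = k \<Longrightarrow> sym_inverse d (moment n ext_row X) H \<Longrightarrow>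
        tr d (mat_of s5) * (real k - real d + 1) * (real B)\<^sup>2 \<le> real k * tr d H * (real B + 1)\<^sup>2"
    using s5(2,3) by (auto simp: shrink_inv_def)
  have "moment (n + d) ext_row (read_design s5) = moment n ext_row (read_design s5)"
    by (rule moment_restrict) (use out in auto)
  then have "sym_inverse d (moment n ext_row (read_design s5)) (mat_of s5)" using r5 by (simp add: ready_def)
  moreover have "(\<Sum>i<n. read_design s5 i) = (\<Sum>i<n + d. read_design s5 i)"
    by (intro sum.mono_neutral_left) (use out in auto)
  then have "(\<Sum>i<n. read_design s5 i) = k" using r5 s5(3) by (simp add: ready_def)
  ultimately show ?thesis using run B bnd by blast
qed

text \<open>The output distribution is a point mass, so the expectation is a single value. Both
  halves of the theorem then reduce to a real inequality for the factor
  \<open>\<rho>\<close>.\<close>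

lemma approximates_if_ratio:
  assumes e1: "\<epsilon> \<le> 1" and rho: "0 < \<rho>"
    and ratio: "\<And>B. 0 < B \<Longrightarrow> 6 * real k \<le> real B * \<epsilon> \<Longrightarrow>
       real k / (real k - real d + 1) * ((real B + 1) / real B)\<^sup>2 \<le> \<rho>"
  shows "approximates design_prog total_time \<rho> n d k \<epsilon> v"
proof -
  obtain s B G where s: "reach total_time design_prog (input_state n d k \<epsilon> v) s"
     and B: "0 < B" "6 * real k \<le> real B * \<epsilon>" and X: "(\<Sum>i<n. read_design s i) = k"
     and G: "sym_inverse d (moment n ext_row (read_design s)) G"
     and bnd: "\<And>X H. (\<Sum>i<n. X i) = k \<Longrightarrow> sym_inverse d (moment n ext_row X) H \<Longrightarrow>
        tr d G * (real k - real d + 1) * (real B)\<^sup>2 \<le> real k * tr d H * (real B + 1)\<^sup>2"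
    using design_prog_correct[OF e1] by blast
  have run: "run total_time design_prog (input_state n d k \<epsilon> v) = return_pmf (Skip, s)"
    by (rule reach_run[OF s])
  have out: "output_pmf design_prog total_time n d k \<epsilon> v = return_pmf (read_design s)"
    unfolding output_pmf_def run by simp
  have le: "ennreal (tr d G) \<le> ennreal \<rho> * a_value n d v Y" if Y: "Y \<in> designs n k" for Y
  proof (cases "a_value n d v Y = \<infinity>")
    \<comment> \<open>A singular competitor has infinite value, and a positive \<open>\<rho>\<close>
      keeps the product infinite.\<close>
    case True
    then show ?thesis using rho by (simp add: ennreal_mult_top)
  next
    case False
    then obtain H where H: "sym_inverse d (moment n ext_row Y) H" by (rule a_value_finiteE)
    let ?m = "real k - real d + 1"
    have m: "0 < ?m" using dk by simp
    have B2: "0 < (real B)\<^sup>2" using B(1) by simp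
    have "tr d G * ?m * (real B)\<^sup>2 \<le> real k * tr d H * (real B + 1)\<^sup>2"
      using Y H by (intro bnd) (auto simp: designs_def)
    then have "tr d G \<le> (real k / ?m * ((real B + 1) / real B)\<^sup>2) * tr d H"
    proof -
      assume "tr d G * ?m * (real B)\<^sup>2 \<le> real k * tr d H * (real B + 1)\<^sup>2"
      then have "tr d G \<le> real k * tr d H * (real B + 1)\<^sup>2 / (?m * (real B)\<^sup>2)"
        using m B2 by (subst pos_le_divide_eq) (auto simp: mult.assoc)
      then show ?thesis by (simp add: power_divide mult_ac)
    qed
    also have "\<dots> \<le> \<rho> * tr d H" by (intro mult_right_mono ratio B tr_nonneg[OF H])
    finally show ?thesis unfolding a_value_eq[OF H]
      using rho tr_nonneg[OF H] by (simp add: ennreal_mult[symmetric] ennreal_leI)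
  qed
  \<comment> \<open>Dividing by \<open>\<rho>\<close> gives a lower bound on every value and hence
    on the infimum, whether or not it is attained.\<close>
  have "ennreal (tr d G) / ennreal \<rho> \<le> OPT_rep n d k v"
    unfolding OPT_rep_def
  proof (rule INF_greatest)
    fix Y assume "Y \<in> designs n k"
    then show "ennreal (tr d G) / ennreal \<rho> \<le> a_value n d v Y"
      using le[of Y] rho by (intro divide_le_posI_ennreal) auto
  qed
  then have "ennreal \<rho> * (ennreal (tr d G) / ennreal \<rho>) \<le> ennreal \<rho> * OPT_rep n d k v"
    by (rule mult_left_mono) simp
  moreover have "ennreal \<rho> * (ennreal (tr d G) / ennreal \<rho>) = ennreal (tr d G)"
    using rho by (simp add: ennreal_times_divide mult.commute[of "ennreal \<rho>"] mult_divide_eq_ennreal)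
  ultimately have "ennreal (tr d G) \<le> ennreal \<rho> * OPT_rep n d k v" by simp
  then show ?thesis
    unfolding approximates_def halts_within_def out run using X a_value_eq[OF G]
    by (simp add: designs_def)
qed

section \<open>Polynomial running time\<close>

lemma total_time_le:
  assumes "\<epsilon> \<le> 1"
  shows "real total_time \<le> 700 * 9 ^ 6 * (real n + real d + real k + 1 / \<epsilon>) ^ 12"
proof -
  \<comment> \<open>\<open>W\<close> dominates all sizes that occur. The order \<open>W^6\<close>
    comes from the greedy phases: \<open>W^3\<close> rounds of cost \<open>W^3\<close> each.\<close>
  define W where "W = n + d + max_copies"
  have W1: "1 \<le> W" and le: "n \<le> W" "d \<le> W" "max_copies \<le> W" unfolding W_def max_copies_def by auto
  have pw: "W ^ i \<le> W ^ j" if "i \<le> j" for i j using that W1 by (intro power_increasing) auto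
  have p: "1 \<le> W ^ 2" "W \<le> W ^ 2" "1 \<le> W ^ 3" "W \<le> W ^ 3" "W ^ 2 \<le> W ^ 3" "1 \<le> W ^ 6" "W \<le> W ^ 6" "W ^ 3 \<le> W ^ 6"
    using pw[of 0 2] pw[of 1 2] pw[of 0 3] pw[of 1 3] pw[of 2 3] pw[of 0 6] pw[of 1 6] pw[of 3 6] by simp_all
  have sq: "W * (a * W + b) = a * W ^ 2 + b * W" "W * (a * W ^ 2 + b) = a * W ^ 3 + b * W" for a b
    by (simp_all add: algebra_simps power2_eq_square power3_eq_cube)
  have "mult_time d \<le> W * (5 * W + 13) + 7"
    unfolding mult_time_def using le by (intro add_mono mult_mono) auto
  also have "\<dots> \<le> 25 * W ^ 2" unfolding sq using p by linarith
  finally have m: "mult_time d \<le> 25 * W ^ 2" .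
  have "update_time d \<le> 25 * W ^ 2 + W * (5 * W + 7) + 8"
    unfolding update_time_def using le m by (intro add_mono mult_mono) auto
  also have "\<dots> \<le> 45 * W ^ 2" unfolding sq using p by linarith
  finally have u: "update_time d \<le> 45 * W ^ 2" .
  have "select_time n d \<le> W * (25 * W ^ 2 + 11) + 5"
    unfolding select_time_def using le m by (intro add_mono mult_mono) auto
  also have "\<dots> \<le> 41 * W ^ 3" unfolding sq using p by linarith
  finally have s: "select_time n d \<le> 41 * W ^ 3" .
  have g: "greedy_time n d + 2 \<le> 91 * W ^ 3"
    unfolding greedy_time_def using s u p by linarith
  have "n * (max_copies * (max_copies + 1)) * (greedy_time n d + 2) \<le> W * (W * (2 * W)) * (91 * W ^ 3)"
    using le W1 g by (intro mult_mono) auto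
  also have "\<dots> = 182 * W ^ 6" by (simp add: power_numeral_reduce)
  finally have big: "n * (max_copies * (max_copies + 1)) * (greedy_time n d + 2) \<le> 182 * W ^ 6" .
  have total_bound: "9 * d + 3 * max_copies + 10 + (b1 + 7) + (b2 + 7) + 2 * (b3 + 5) + 4
      \<le> 9 * W + 3 * W + 10 + (51 * z + 7) + (51 * z + 7) + 2 * (182 * x + 5) + 4"
    if "b1 \<le> w" "b2 \<le> w" "w \<le> 51 * z" "b3 \<le> 182 * x" for b1 b2 b3 w x z
    using that le by simp
  have a1: "n * (update_time d + 6) \<le> W * (45 * W ^ 2 + 6)" "d * (update_time d + 6) \<le> W * (45 * W ^ 2 + 6)"
    using le u by (intro mult_mono add_mono; simp)+
  have a2: "W * (45 * W ^ 2 + 6) \<le> 51 * W ^ 3"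
    unfolding sq using p by linarith
  have "total_time \<le> 9 * W + 3 * W + 10 + (51 * W ^ 3 + 7) + (51 * W ^ 3 + 7) + 2 * (182 * W ^ 6 + 5) + 4"
    unfolding total_time_def by (rule total_bound[OF a1 a2 big])
  also have "\<dots> \<le> 700 * W ^ 6"
  proof -
    have "9 * x + 3 * x + 10 + (51 * z + 7) + (51 * z + 7) + 2 * (182 * y + 5) + 4 \<le> 700 * y"
      if "1 \<le> y" "x \<le> y" "z \<le> y" for x y z :: nat using that by simp
    then show ?thesis using p(6-8) .
  qed
  finally have T: "total_time \<le> 700 * W ^ 6" .
  define S where "S = real n + real d + real k + 1 / \<epsilon>"
  have ie: "1 \<le> 1 / \<epsilon>" using eps assms by simp
  have S1: "1 \<le> S" unfolding S_def using ie by linarith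
  have kS: "real k \<le> S" and eS: "1 / \<epsilon> \<le> S" unfolding S_def using ie by linarith+
  \<comment> \<open>\<open>max_copies\<close> is of order \<open>k / \<epsilon>\<close>, hence of
    order \<open>S^2\<close>; this doubles the exponent to 12, and
    \<open>6 S^2 + S + 2 <= 9 S^2\<close> gives the constant.\<close>
  have "real k * (1 / \<epsilon>) \<le> S * S" using kS eS S1 eps by (intro mult_mono) auto
  then have "6 * real k / \<epsilon> \<le> 6 * S\<^sup>2" by (simp add: power2_eq_square)
  moreover have "real max_copies \<le> 6 * real k / \<epsilon> + 2" unfolding max_copies_def using eps by simp linarith
  moreover have "real n + real d \<le> S" unfolding S_def using ie by linarith
  moreover have "S \<le> S\<^sup>2" "1 \<le> S\<^sup>2" using S1 by (auto simp: power2_eq_square intro: order_trans mult_mono[of 1 S 1 S, simplified])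
  ultimately have "real W \<le> 9 * S\<^sup>2" unfolding W_def of_nat_add by linarith
  then have "real W ^ 6 \<le> (9 * S\<^sup>2) ^ 6" by (intro power_mono) auto
  also have "\<dots> = 9 ^ 6 * S ^ 12" by (simp add: power_mult_distrib flip: power_mult)
  finally have "700 * real W ^ 6 \<le> 700 * 9 ^ 6 * S ^ 12" by simp
  moreover have "real total_time \<le> 700 * real W ^ 6"
    using T by (metis of_nat_le_iff of_nat_mult of_nat_numeral of_nat_power)
  ultimately show ?thesis unfolding S_def by linarith
qed

end

theorem theorem1p5:
  shows "(\<exists>(alg :: com) (C :: real) (c :: nat). \<forall>(n :: nat) (d :: nat) (k :: nat) (\<epsilon> :: real) (v :: nat \<Rightarrow> real vec).
            1 \<le> d \<and> d \<le> k \<and> 0 < \<epsilon> \<and> \<epsilon> \<le> 1 \<and> spanning_vectors n d v \<longrightarrow>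
            (\<exists>t. real t \<le> C * (real n + real d + real k + 1 / \<epsilon>) ^ c \<and>
                 approximates alg t (real k / (real k - real d + 1) + \<epsilon>) n d k \<epsilon> v)) \<and>
         (\<exists>(alg :: com) (C :: real) (c :: nat). \<forall>(n :: nat) (d :: nat) (k :: nat) (\<epsilon> :: real) (v :: nat \<Rightarrow> real vec).
            1 \<le> d \<and> d \<le> k \<and> 0 < \<epsilon> \<and> \<epsilon> \<le> 1 \<and> spanning_vectors n d v \<and>
            real k \<ge> real d + real d / \<epsilon> \<longrightarrow>
            (\<exists>t. real t \<le> C * (real n + real d + real k + 1 / \<epsilon>) ^ c \<and>
                 approximates alg t (1 + \<epsilon>) n d k \<epsilon> v))"
\<comment> \<open>One program and one time bound serve both halves; the constants are those of
  \<open>total_time_le\<close>.\<close>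
proof ((rule conjI; (rule exI[of _ design_prog], rule exI[of _ "700 * 9 ^ 6"], rule exI[of _ 12], intro allI impI)), goal_cases)
  case (1 n d k \<epsilon> v)
  then interpret design_instance n d k \<epsilon> v by unfold_locales auto
  have "real k / (real k - real d + 1) * ((real B + 1) / real B)\<^sup>2 \<le> real k / (real k - real d + 1) + \<epsilon>"
    if B: "0 < B" "6 * real k \<le> real B * \<epsilon>" for B :: nat
  proof -
    \<comment> \<open>Since \<open>k - d + 1 >= 1\<close>, the relative overhead
      \<open>3 / B\<close> costs at most \<open>3 k / B\<close>, which the choice of
      \<open>B\<close> keeps below \<open>\<epsilon>\<close>.\<close>
    have "real k / (real k - real d + 1) \<le> real k / 1" using 1 by (intro divide_left_mono) auto
    then have "real k / (real k - real d + 1) * (3 / real B) \<le> real k * (3 / real B)"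
      by (intro mult_right_mono) auto
    also have "\<dots> \<le> \<epsilon>" using B by (simp add: field_simps)
    finally have small: "real k / (real k - real d + 1) * (3 / real B) \<le> \<epsilon>" .
    have "real k / (real k - real d + 1) * ((real B + 1) / real B)\<^sup>2 \<le> real k / (real k - real d + 1) * (1 + 3 / real B)"
      using 1 overhead_square_le[OF B(1)] by (intro mult_left_mono) auto
    then show ?thesis using small by (simp add: distrib_left)
  qed
  moreover have "0 < real k / (real k - real d + 1) + \<epsilon>" using 1 by (intro add_nonneg_pos) auto
  ultimately have "approximates design_prog total_time (real k / (real k - real d + 1) + \<epsilon>) n d k \<epsilon> v"
    using 1 by (intro approximates_if_ratio) auto
  then show ?case using total_time_le 1 by blast
next
  case (2 n d k \<epsilon> v)
  then interpret design_instance n d k \<epsilon> v by unfold_locales auto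
  let ?m = "real k - real d + 1"
  have m: "0 < ?m" using 2 by simp
  have de: "real d \<le> (real k - real d) * \<epsilon>" proof -
    have "real d / \<epsilon> \<le> real k - real d" using 2 by linarith
    then show ?thesis using 2 by (simp add: pos_divide_le_eq)
  qed
  have "real k / ?m * ((real B + 1) / real B)\<^sup>2 \<le> 1 + \<epsilon>"
    if B: "0 < B" "6 * real k \<le> real B * \<epsilon>" for B :: nat
  proof -
    have "3 * real k / real B \<le> \<epsilon> / 2" using B by (simp add: field_simps)
    then have b: "3 / real B * real k \<le> \<epsilon> / 2" by simp
    have "real k * (1 + 3 / real B) \<le> real k + \<epsilon> / 2" using b by (simp add: algebra_simps)
    \<comment> \<open>The hypothesis \<open>k >= d + d / \<epsilon>\<close> means
      \<open>d <= (k - d) \<epsilon>\<close>, so the right side is at least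
      \<open>k + 1 + \<epsilon>\<close>. This absorbs the overhead, whereas adding
      \<open>\<epsilon>\<close> to \<open>k / (k - d + 1)\<close> as in the first half could exceed
      \<open>1 + \<epsilon>\<close>.\<close>
    also have "\<dots> \<le> (1 + \<epsilon>) * ?m"
    proof -
      have "(1 + \<epsilon>) * ?m = real k - real d + 1 + (real k - real d) * \<epsilon> + \<epsilon>" by (simp add: algebra_simps)
      then show ?thesis using de 2 by linarith
    qed
    finally have "real k / ?m * (1 + 3 / real B) \<le> 1 + \<epsilon>" using m by (simp add: field_simps)
    moreover have "real k / ?m * ((real B + 1) / real B)\<^sup>2 \<le> real k / ?m * (1 + 3 / real B)"
      using m overhead_square_le[OF B(1)] by (intro mult_left_mono) auto
    ultimately show ?thesis by linarith
  qed
  then have "approximates design_prog total_time (1 + \<epsilon>) n d k \<epsilon> v"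
    using 2 by (intro approximates_if_ratio) auto
  then show ?case using total_time_le 2 by blast
qed

end
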